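(* Let $Q$ be the cube graph. Every biminimal pot that $3$-realizes $Q$, i.e. every pot $P$ that $3$-realizes $Q$ with $|P|=T_3(Q)$ and $|\Sigma(P)|=B_3(Q)$, is isomorphic (as a pot) to one of the following two pots: (i) $P_1=\big\{\{1,1,1\},\{2,2,2\},\{-2,-3,-3\},\{-1,-4,-4\},\{-1,3,-5\},\{-2,4,5\}\big\}$; (ii) $P_2=\big\{\{1,1,1\},\{2,2,2\},\{-2,-3,-3\},\{-1,-4,-4\},\{3,4,5\},\{-1,-2,-5\}\big\}$. (Here the inner braces denote multisets.)
   Context: Graphs are connected, have non-empty vertex set, and may have loops and multiple edges. Formally a graph is a triple $(V(G),E(G),\mu)$ with $\mu$ assigning to each edge an unordered pair of (not necessarily distinct) vertices (undirected graph) or an ordered pair of vertices (directed graph). An orientation $\vec G$ of an undirected graph $G$ is a directed graph obtained by choosing a direction for every edge of $G$. The cube $Q$ is the simple undirected graph with vertex set $\mathbb{Z}_2^3$ in which $x,y$ are adjacent iff $x-y\in\{100,010,001\}$. An edge-coloring of a graph with $c$ colors is any map $\lambda$ from its edge set to $[1,c]=\{1,\dots,c\}$ (no properness required). A tile is a finite multiset of integers; a pot is a set of tiles. $\Sigma(P)$ is the set of positive integers (colors) appearing in some tile of the pot $P$. For an edge-coloring $\lambda$ of a directed graph $D$ and a vertex $x$, the tile $\tau_x(\lambda)$ is the multiset containing one copy of $\lambda(e)$ for each non-loop edge $e$ with tail $x$ (i.e. $e=(x,y)$, $y\ne x$), one copy of $-\lambda(e)$ for each non-loop edge $e$ with head $x$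 (i.e. $e=(y,x)$, $y\neq x$), and both $\lambda(e)$ and $-\lambda(e)$ for each loop $e$ at $x$. The pot induced by $\lambda$ is $\mathcal{P}(\lambda)=\{\tau_x(\lambda)\mid x\in V(D)\}$ (a set of distinct tiles). A pot $P$ realizes an undirected graph $G$, written $G\in\mathcal{O}(P)$, if there is an edge-coloring $\lambda$ of some orientation of $G$ with $\mathcal{P}(\lambda)\subseteq P$ (such $\lambda$ is a realization of $G$ through $P$). $P$ $3$-realizes $G$ if $G\in\mathcal{O}(P)$ and there is no $H\in\mathcal{O}(P)$ with $H\not\simeq G$ and $|V(H)|\le|V(G)|$. $T_3(G)=\min\{|P| : P \text{ is a pot that 3-realizes } G\}$ and $B_3(G)=\min\{|\Sigma(P)| : P \text{ is a pot that 3-realizes } G\}$ (two independent minima). A pot $P$ that $3$-realizes $G$ is biminimal if $|P|=T_3(G)$ and $|\Sigma(P)|=B_3(G)$. Two pots $P,P'$ are isomorphic if there is a bijection $f:\pm\Sigma(P)\to\pm\Sigma(P')$, where $\pm X=X\cup(-X)$, with $f(-i)=-f(i)$ for all $i$ and $f(P)=P'$, where $f$ is applied elementwise (with multiplicity) to tiles and to each tile of a pot. *)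

theory Defs
  imports
    "Graph_Theory.Digraph"
    "HOL-Library.Multiset"
    "HOL-Library.FuncSet"
    "HOL-Library.Uprod"
    "HOL-Library.Extended_Nat"
    "HOL-Library.Z2"
    "HOL-Library.Product_Plus"
begin

section \<open>Undirected multigraphs\<close>

text \<open>Loops are edges whose unordered pair of ends has the form \<open>Upair v v\<close>.
  Directed graphs are the \<open>pre_digraph\<close> records of \<open>Graph_Theory\<close>.\<close>

record ('v, 'e) ugraph =
  uverts :: "'v set"
  uedges :: "'e set"
  uends :: "'e \<Rightarrow> 'v uprod"

definition uadj :: "('v, 'e) ugraph \<Rightarrow> ('v \<times> 'v) set" where
  "uadj G = {(x, y). \<exists>e\<in>uedges G. uends G e = Upair x y}"

definition is_graph :: "('v, 'e) ugraph \<Rightarrow> bool" where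
  "is_graph G \<longleftrightarrow>
     finite (uverts G) \<and> finite (uedges G) \<and> uverts G \<noteq> {} \<and>
     (\<forall>e\<in>uedges G. set_uprod (uends G e) \<subseteq> uverts G) \<and>
     (\<forall>x\<in>uverts G. \<forall>y\<in>uverts G. (x, y) \<in> (uadj G)\<^sup>*)"

definition graph_iso :: "('v, 'e) ugraph \<Rightarrow> ('w, 'f) ugraph \<Rightarrow> bool" where
  "graph_iso G H \<longleftrightarrow>
     (\<exists>f g. bij_betw f (uverts G) (uverts H) \<and> bij_betw g (uedges G) (uedges H) \<and>
        (\<forall>e\<in>uedges G. uends H (g e) = map_uprod f (uends G e)))"

definition orientation_of :: "('v, 'e) pre_digraph \<Rightarrow> ('v, 'e) ugraph \<Rightarrow> bool" where
  "orientation_of D G \<longleftrightarrow>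
     verts D = uverts G \<and> arcs D = uedges G \<and>
     (\<forall>e\<in>arcs D. Upair (tail D e) (head D e) = uends G e)"

definition cube :: "(bit \<times> bit \<times> bit, (bit \<times> bit \<times> bit) uprod) ugraph" where
  "cube = \<lparr> uverts = UNIV,
            uedges = {Upair x y | x y. x - y \<in> {(1, 0, 0), (0, 1, 0), (0, 0, 1)}},
            uends = (\<lambda>e. e) \<rparr>"

section \<open>Tiles, pots and realizations\<close>

type_synonym tile = "int multiset"
type_synonym pot = "tile set"

definition colors :: "pot \<Rightarrow> int set" where
  "colors P = {c. c > 0 \<and> (\<exists>t\<in>P. c \<in># t)}"

definition edge_coloring :: "('v, 'e) pre_digraph \<Rightarrow> nat \<Rightarrow> ('e \<Rightarrow> int) \<Rightarrow> bool" where
  "edge_coloring D c l \<longleftrightarrow> l \<in> arcs D \<rightarrow> {1..int c}"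

text \<open>A loop at \<open>x\<close> belongs to both index sets below, so that it contributes its color with
  both signs.\<close>

definition tile_at :: "('v, 'e) pre_digraph \<Rightarrow> ('e \<Rightarrow> int) \<Rightarrow> 'v \<Rightarrow> tile" where
  "tile_at D l x =
     image_mset l (mset_set {e \<in> arcs D. tail D e = x}) +
     image_mset (\<lambda>e. - l e) (mset_set {e \<in> arcs D. head D e = x})"

definition induced_pot :: "('v, 'e) pre_digraph \<Rightarrow> ('e \<Rightarrow> int) \<Rightarrow> pot" where
  "induced_pot D l = tile_at D l ` verts D"

definition realizes :: "pot \<Rightarrow> ('v, 'e) ugraph \<Rightarrow> bool" where
  "realizes P G \<longleftrightarrow>
     is_graph G \<and>
     (\<exists>D c l. orientation_of D G \<and> edge_coloring D c l \<and> induced_pot D l \<subseteq> P)"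

text \<open>Competing graphs \<open>H\<close> range over graphs with vertices and edges in \<open>nat\<close>. As graphs are
  finite, these represent all graphs up to isomorphism.\<close>

definition three_realizes :: "pot \<Rightarrow> ('v, 'e) ugraph \<Rightarrow> bool" where
  "three_realizes P G \<longleftrightarrow>
     realizes P G \<and>
     \<not> (\<exists>H :: (nat, nat) ugraph.
          realizes P H \<and> \<not> graph_iso H G \<and> card (uverts H) \<le> card (uverts G))"

text \<open>Pots may be infinite, whereas \<open>card\<close> would assign size \<open>0\<close> to an infinite set.\<close>

definition ecard :: "'a set \<Rightarrow> enat" where
  "ecard A = (if finite A then enat (card A) else \<infinity>)"

text \<open>As \<open>enat\<close> is well-ordered, these infima over nonempty sets are minima.\<close>

definition T3 :: "('v, 'e) ugraph \<Rightarrow> enat" where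
  "T3 G = (INF P\<in>{P. three_realizes P G}. ecard P)"

definition B3 :: "('v, 'e) ugraph \<Rightarrow> enat" where
  "B3 G = (INF P\<in>{P. three_realizes P G}. ecard (colors P))"

definition biminimal :: "pot \<Rightarrow> ('v, 'e) ugraph \<Rightarrow> bool" where
  "biminimal P G \<longleftrightarrow> three_realizes P G \<and> ecard P = T3 G \<and> ecard (colors P) = B3 G"

section \<open>Isomorphism of pots\<close>

definition signed :: "int set \<Rightarrow> int set" where
  "signed X = X \<union> uminus ` X"

text \<open>HOL functions are total, so the first conjunct expresses that \<open>f\<close> is only applied to
  elements of its domain \<open>signed (colors P)\<close>.\<close>

definition pot_iso :: "pot \<Rightarrow> pot \<Rightarrow> bool" where
  "pot_iso P P' \<longleftrightarrow>
     (\<forall>t\<in>P. set_mset t \<subseteq> signed (colors P)) \<and>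
     (\<exists>f. bij_betw f (signed (colors P)) (signed (colors P')) \<and>
        (\<forall>i\<in>signed (colors P). f (- i) = - f i) \<and>
        image_mset f ` P = P')"

end

(*
  If two arcs of a realization have the same color, exchanging their heads preserves all tiles, so
  the result must again be a cube; hence equally colored arcs share their tails, share their heads
  or are antipodal. The pot P1 turns out to 3-realize the cube, so a biminimal pot has at most six
  tiles and five colors and is induced by a single coloring. Two distinct vertices with equal tiles
  must then be at distance two, no three vertices have equal tiles, and the two disjoint pairs of
  equal tiles x, y and r, s that must exist sit in opposite faces of the cube. This determines the
  coloring up to two binary choices, which lead to P1 or P2.
*)

theory Submission
  imports Defs
begin

section \<open>Transfer and connectedness of realizations\<close>

text \<open>Exchanging heads may disconnect the cube or create loops and parallel edges, while
  competing graphs are connected; a component that realizes a graph by itself closes this gap. The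
  rest is bipartiteness: the cube stays connected after losing two disjoint edges, so the
  bipartition of the new cube agrees with the old one, and each new edge joins vertices of opposite
  parity. Adjacent ones would give a parallel edge, so they are antipodal. The bound six on tiles,
  against eight vertices, produces the two pairs of equal tiles. The bound five on colors places the
  second pair and leaves little room for the two edges that join a common neighbor of
  \<open>x, y\<close> to a common neighbor of \<open>r, s\<close>: each repeats, at one of its ends,
  the color of the other two edges there, so that this end gets a tile with a single color. These
  are the two binary choices. The two monochromatic vertices are antipodal for \<open>P1\<close> and
  at distance two for \<open>P2\<close>.\<close>

lemma graph_iso_trans:
  assumes "graph_iso G H" "graph_iso H K"
  shows "graph_iso G K"
proof -
  obtain f g where 1: "bij_betw f (uverts G) (uverts H)" "bij_betw g (uedges G) (uedges H)"
    "\<And>e. e \<in> uedges G \<Longrightarrow> uends H (g e) = map_uprod f (uends G e)"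
    using assms(1) unfolding graph_iso_def by blast
  obtain f' g' where 2: "bij_betw f' (uverts H) (uverts K)" "bij_betw g' (uedges H) (uedges K)"
    "\<And>e. e \<in> uedges H \<Longrightarrow> uends K (g' e) = map_uprod f' (uends H e)"
    using assms(2) unfolding graph_iso_def by blast
  have "uends K ((g' \<circ> g) e) = map_uprod (f' \<circ> f) (uends G e)" if "e \<in> uedges G" for e
    using 1(3)[OF that] 2(3)[of "g e"] bij_betwE[OF 1(2)] that by (simp add: uprod.map_comp)
  then show ?thesis
    unfolding graph_iso_def using bij_betw_trans[OF 1(1) 2(1)] bij_betw_trans[OF 1(2) 2(2)] by blast
qed

text \<open>Competing graphs live on \<open>nat\<close>, whereas the graphs constructed below
  inherit other types; this transports them. The ends of a new edge are read off at its preimage,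
  which is meaningful when \<open>g\<close> is injective on the edges.\<close>

definition relabel :: "('v \<Rightarrow> 'w) \<Rightarrow> ('e \<Rightarrow> 'f) \<Rightarrow> ('v, 'e) ugraph \<Rightarrow> ('w, 'f) ugraph" where
  "relabel f g H = \<lparr> uverts = f ` uverts H, uedges = g ` uedges H,
     uends = (\<lambda>n. map_uprod f (uends H (inv_into (uedges H) g n))) \<rparr>"

lemma graph_iso_relabel:
  assumes "inj_on f (uverts H)" "inj_on g (uedges H)"
  shows "graph_iso H (relabel f g H)"
  unfolding graph_iso_def relabel_def
  by (intro exI[of _ f] exI[of _ g]) (use assms in \<open>auto simp: bij_betw_def\<close>)

lemma is_graph_relabel:
  assumes H: "is_graph H" and f: "inj_on f (uverts H)" and g: "inj_on g (uedges H)"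
  shows "is_graph (relabel f g H)"
proof -
  have fin: "finite (uverts H)" "finite (uedges H)" "uverts H \<noteq> {}"
    and ends: "\<And>e. e \<in> uedges H \<Longrightarrow> set_uprod (uends H e) \<subseteq> uverts H"
    and conn: "\<And>x y. x \<in> uverts H \<Longrightarrow> y \<in> uverts H \<Longrightarrow> (x, y) \<in> (uadj H)\<^sup>*"
    using H unfolding is_graph_def by auto
  have step: "(f x, f y) \<in> uadj (relabel f g H)" if xy: "(x, y) \<in> uadj H" for x y
  proof -
    obtain e where e: "e \<in> uedges H" "uends H e = Upair x y"
      using xy by (auto simp: uadj_def)
    then show ?thesis
      using g by (auto simp: uadj_def relabel_def intro!: bexI[of _ e])
  qed
  have star: "(f x, f y) \<in> (uadj (relabel f g H))\<^sup>*" if "(x, y) \<in> (uadj H)\<^sup>*" for x y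
    using that by induction (auto intro: step rtrancl_into_rtrancl)
  show ?thesis
    unfolding is_graph_def
  proof (intro conjI ballI)
    fix e assume "e \<in> uedges (relabel f g H)"
    then obtain e' where "e' \<in> uedges H" "e = g e'" by (auto simp: relabel_def)
    then show "set_uprod (uends (relabel f g H) e) \<subseteq> uverts (relabel f g H)"
      using ends[of e'] g by (auto simp: relabel_def uprod.set_map)
  next
    fix x y assume "x \<in> uverts (relabel f g H)" "y \<in> uverts (relabel f g H)"
    then show "(x, y) \<in> (uadj (relabel f g H))\<^sup>*"
      using conn star by (auto simp: relabel_def)
  qed (use fin in \<open>auto simp: relabel_def\<close>)
qed

lemma realizes_relabel:
  fixes H :: "('v, 'e) ugraph"
  assumes H: "realizes P H" and f: "inj_on f (uverts H)" and g: "inj_on g (uedges H)"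
  shows "realizes P (relabel f g H)"
proof -
  have gr: "is_graph H" using H by (simp add: realizes_def)
  obtain D c l where D: "orientation_of D H" "edge_coloring D c l" "induced_pot D l \<subseteq> P"
    using H by (auto simp: realizes_def)
  have vD: "verts D = uverts H" and aD: "arcs D = uedges H"
    and eD: "\<And>e. e \<in> uedges H \<Longrightarrow> uends H e = Upair (tail D e) (head D e)"
    using D(1) unfolding orientation_of_def by auto
  have mem: "tail D e \<in> uverts H" "head D e \<in> uverts H" if "e \<in> uedges H" for e
    using gr that eD[OF that] unfolding is_graph_def by fastforce+
  define h where "h = inv_into (uedges H) g"
  define D' where "D' = \<lparr>verts = f ` uverts H, arcs = g ` uedges H,
    tail = (\<lambda>n. f (tail D (h n))), head = (\<lambda>n. f (head D (h n)))\<rparr>"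
  have hg: "h (g e) = e" if "e \<in> uedges H" for e
    using g that by (simp add: h_def)
  have o: "orientation_of D' (relabel f g H)"
    unfolding orientation_of_def
    by (auto simp: D'_def relabel_def h_def[symmetric] hg eD)
  have c: "edge_coloring D' c (l \<circ> h)"
    using D(2) by (auto simp: edge_coloring_def D'_def hg aD)
  \<comment> \<open>Covers both halves of a tile: outgoing arcs with \<open>m = l\<close> and
    \<open>u = tail D\<close>, incoming arcs with \<open>m\<close> the negated coloring and
    \<open>u = head D\<close>.\<close>
  have *: "image_mset (\<lambda>e. m (h e)) (mset_set {n \<in> g ` uedges H. f (u (h n)) = f x})
      = image_mset m (mset_set {e \<in> uedges H. u e = x})"
    if "x \<in> uverts H" "\<And>e. e \<in> uedges H \<Longrightarrow> u e \<in> uverts H" for m :: "'e \<Rightarrow> int" and u :: "'e \<Rightarrow> 'v" and x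
  proof -
    have "{n \<in> g ` uedges H. f (u (h n)) = f x} = g ` {e \<in> uedges H. u e = x}"
      using that f by (auto simp: hg inj_on_eq_iff)
    moreover have "mset_set (g ` {e \<in> uedges H. u e = x}) = image_mset g (mset_set {e \<in> uedges H. u e = x})"
      by (rule image_mset_mset_set[symmetric]) (use g in \<open>auto intro: inj_on_subset\<close>)
    moreover have "finite (uedges H)" using gr by (simp add: is_graph_def)
    ultimately show ?thesis
      by (auto simp: multiset.map_comp hg intro!: image_mset_cong)
  qed
  have "tile_at D' (l \<circ> h) (f x) = tile_at D l x" if "x \<in> uverts H" for x
    using *[where m = l and u = "tail D", OF that mem(1)]
      *[where m = "\<lambda>e. - l e" and u = "head D", OF that mem(2)]
    by (simp add: tile_at_def D'_def aD o_def)
  then have "induced_pot D' (l \<circ> h) \<subseteq> P"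
    using D(3) by (auto simp: induced_pot_def D'_def vD)
  then show ?thesis
    unfolding realizes_def using o c is_graph_relabel[OF gr f g] by blast
qed

text \<open>Frees the competing graph from the type \<open>nat\<close>: a finite graph has an
  injective relabeling there.\<close>

lemma three_realizes_graph_iso:
  fixes H :: "('v, 'e) ugraph"
  assumes "three_realizes P G" and H: "realizes P H" and "card (uverts H) \<le> card (uverts G)"
  shows "graph_iso H G"
proof -
  have "finite (uverts H)" "finite (uedges H)"
    using H by (auto simp: realizes_def is_graph_def)
  then obtain f :: "'v \<Rightarrow> nat" and g :: "'e \<Rightarrow> nat"
    where fg: "inj_on f (uverts H)" "inj_on g (uedges H)"
    using finite_imp_inj_to_nat_seg by metis
  have "card (uverts (relabel f g H)) = card (uverts H)"
    using fg by (simp add: relabel_def card_image)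
  then have "graph_iso (relabel f g H) G"
    using assms realizes_relabel[OF H fg] by (auto simp: three_realizes_def)
  then show ?thesis
    using graph_iso_relabel[OF fg] graph_iso_trans by blast
qed

definition underlying :: "('v, 'e) pre_digraph \<Rightarrow> ('v, 'e) ugraph" where
  "underlying D = \<lparr> uverts = verts D, uedges = arcs D,
     uends = (\<lambda>e. Upair (tail D e) (head D e)) \<rparr>"

lemma graph_iso_card_verts:
  "graph_iso G H \<Longrightarrow> card (uverts G) = card (uverts H)"
  by (auto simp: graph_iso_def dest: bij_betw_same_card)

text \<open>Each component of \<open>D\<close> realizes a graph through \<open>P\<close>, so it already has as many
  vertices as \<open>G\<close>, and \<open>D\<close> is connected.\<close>

lemma three_realizes_underlying_iso:
  assumes P: "three_realizes P G" and D: "fin_digraph D"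
    and ne: "verts D \<noteq> {}" and card: "card (verts D) \<le> card (uverts G)"
    and l: "edge_coloring D c l" and pot: "induced_pot D l \<subseteq> P"
  shows "graph_iso (underlying D) G"
proof -
  interpret fin_digraph D by fact
  obtain v where v: "v \<in> verts D" using ne by blast
  let ?R = "uadj (underlying D)"
  have sym: "sym ?R" by (auto simp: sym_def uadj_def underlying_def)
  have arcR: "(tail D e, head D e) \<in> ?R" "(head D e, tail D e) \<in> ?R" if "e \<in> arcs D" for e
    using that by (auto simp: uadj_def underlying_def)
  define C where "C = {y. (v, y) \<in> ?R\<^sup>*}"
  have vC: "v \<in> C" by (simp add: C_def)
  have closed: "tail D e \<in> C \<longleftrightarrow> head D e \<in> C" if "e \<in> arcs D" for e
    using arcR[OF that] unfolding C_def by (auto intro: rtrancl_into_rtrancl)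
  have CV: "C \<subseteq> verts D"
  proof
    fix y assume "y \<in> C"
    then have "(v, y) \<in> ?R\<^sup>*" by (simp add: C_def)
    then show "y \<in> verts D"
      by induction (use v in \<open>auto simp: uadj_def underlying_def\<close>)
  qed
  \<comment> \<open>Selecting arcs by their tails suffices, since by \<open>closed\<close> a
    component contains both ends of an arc or neither. For the same reason no tile at a vertex of
    \<open>C\<close> changes.\<close>
  define D' where "D' = D\<lparr>verts := C, arcs := {e \<in> arcs D. tail D e \<in> C}\<rparr>"
  have sym': "sym (uadj (underlying D'))" by (auto simp: sym_def uadj_def underlying_def)
  have conn: "(v, y) \<in> (uadj (underlying D'))\<^sup>*" if "(v, y) \<in> ?R\<^sup>*" for y
    using that
  proof induction
    case (step y z)
    have "y \<in> C" using step(1) by (simp add: C_def)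
    then have "(y, z) \<in> uadj (underlying D')"
      using step(2) closed by (auto simp: uadj_def underlying_def D'_def)
    then show ?case using step by auto
  qed auto
  have gr: "is_graph (underlying D')"
    unfolding is_graph_def
  proof (intro conjI ballI)
    fix x y assume "x \<in> uverts (underlying D')" "y \<in> uverts (underlying D')"
    then have "(v, x) \<in> (uadj (underlying D'))\<^sup>*" "(v, y) \<in> (uadj (underlying D'))\<^sup>*"
      using conn by (auto simp: underlying_def D'_def C_def)
    then show "(x, y) \<in> (uadj (underlying D'))\<^sup>*"
      using sym_rtrancl[OF sym'] by (meson rtrancl_trans symE)
  qed (use vC CV closed finite_verts in \<open>auto simp: underlying_def D'_def intro: finite_subset\<close>)
  have "tile_at D' l x = tile_at D l x" if "x \<in> C" for x
  proof -
    have "{e \<in> arcs D'. tail D' e = x} = {e \<in> arcs D. tail D e = x}"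
      "{e \<in> arcs D'. head D' e = x} = {e \<in> arcs D. head D e = x}"
      using that closed by (auto simp: D'_def)
    then show ?thesis by (simp add: tile_at_def)
  qed
  then have "induced_pot D' l \<subseteq> P"
    using pot CV by (auto simp: induced_pot_def D'_def)
  moreover have "edge_coloring D' c l"
    using l by (auto simp: edge_coloring_def D'_def)
  moreover have "orientation_of D' (underlying D')"
    by (simp add: orientation_of_def underlying_def)
  ultimately have "realizes P (underlying D')"
    using gr unfolding realizes_def by blast
  moreover have cC: "card (uverts (underlying D')) \<le> card (uverts G)"
    using card card_mono[OF finite_verts CV] by (simp add: underlying_def D'_def)
  ultimately have iso: "graph_iso (underlying D') G"
    using three_realizes_graph_iso[OF P] by blast
  have "card C = card (verts D)"
    using graph_iso_card_verts[OF iso] card card_mono[OF finite_verts CV]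
    by (simp add: underlying_def D'_def)
  then have "C = verts D"
    using CV finite_verts by (simp add: card_subset_eq)
  then have "underlying D' = underlying D"
    by (auto simp: underlying_def D'_def)
  then show ?thesis using iso by simp
qed

section \<open>Colorings of the cube\<close>

type_synonym vertex = "bit \<times> bit \<times> bit"

definition adj :: "vertex \<Rightarrow> vertex \<Rightarrow> bool" where
  "adj x y \<longleftrightarrow> x - y \<in> {(1, 0, 0), (0, 1, 0), (0, 0, 1)}"

definition antipode :: "vertex \<Rightarrow> vertex" where
  "antipode x = x + (1, 1, 1)"

definition parity :: "vertex \<Rightarrow> bit" where
  "parity x = fst x + fst (snd x) + snd (snd x)"

section \<open>Bipartition and connectivity of the cube\<close>

lemma bit_cases: "(b::bit) = 0 \<or> b = 1"
  by (cases b) auto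

text \<open>Makes statements about vertices finite checks that the simplifier can evaluate
  coordinate by coordinate.\<close>

lemma vertex_all:
  "(\<forall>x. Q x) \<longleftrightarrow> Q (0,0,0) \<and> Q (0,0,1) \<and> Q (0,1,0) \<and> Q (0,1,1) \<and>
     Q (1,0,0) \<and> Q (1,0,1) \<and> Q (1,1,0) \<and> Q (1,1,1)" for Q :: "vertex \<Rightarrow> bool"
proof -
  have bit_all: "(\<forall>b. R b) \<longleftrightarrow> R 0 \<and> R 1" for R :: "bit \<Rightarrow> bool"
    using bit_cases by metis
  show ?thesis by (simp add: split_paired_All bit_all)
qed

lemma UNIV_vertex:
  "(UNIV :: vertex set) = {(0,0,0), (0,0,1), (0,1,0), (0,1,1), (1,0,0), (1,0,1), (1,1,0), (1,1,1)}"
proof -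
  have *: "\<forall>x :: vertex. x \<in> {(0,0,0), (0,0,1), (0,1,0), (0,1,1), (1,0,0), (1,0,1), (1,1,0), (1,1,1)}"
    unfolding vertex_all by simp
  show ?thesis by (rule UNIV_eq_I) (rule spec[OF *])
qed

lemma finite_vertex: "finite (A :: vertex set)"
  by (rule finite_subset[OF subset_UNIV]) (simp only: UNIV_vertex finite.intros)

lemma adj_sym: "adj x y \<longleftrightarrow> adj y x"
proof -
  have "\<forall>x y. adj x y \<longleftrightarrow> adj y x"
    unfolding vertex_all by (simp add: zero_prod_def adj_def)
  then show ?thesis by blast
qed

lemma adj_parity: "adj x y \<Longrightarrow> parity x \<noteq> parity y"
proof -
  have "\<forall>x y. adj x y \<longrightarrow> parity x \<noteq> parity y"
    unfolding vertex_all by (simp add: zero_prod_def adj_def parity_def)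
  then show "adj x y \<Longrightarrow> parity x \<noteq> parity y" by blast
qed

lemma adj_irrefl [simp]: "\<not> adj x x"
  using adj_parity by blast

text \<open>Vertices in different classes of the bipartition differ in one or in all three
  coordinates.\<close>

lemma parity_neq: "parity x \<noteq> parity y \<Longrightarrow> adj x y \<or> y = antipode x"
proof -
  have "\<forall>x y. parity x \<noteq> parity y \<longrightarrow> adj x y \<or> y = antipode x"
    unfolding vertex_all by (simp add: zero_prod_def adj_def parity_def antipode_def)
  then show "parity x \<noteq> parity y \<Longrightarrow> adj x y \<or> y = antipode x" by blast
qed

text \<open>An edge lies on two faces, and the remaining three sides of each face form a detour. The
  vectors \<open>u, v\<close> are the two directions other than that of the edge.\<close>

lemma adj_two_detours:
  assumes "adj x y"
  obtains a b a' b' where "adj x a" "adj a b" "adj b y" "adj x a'" "adj a' b'" "adj b' y"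
    "{a, b} \<inter> {a', b'} = {}" "{x, y} \<inter> {a, b, a', b'} = {}"
proof -
  define Q where "Q x y u v \<longleftrightarrow> adj x (x + u) \<and> adj (x + u) (y + u) \<and> adj (y + u) y \<and>
      adj x (x + v) \<and> adj (x + v) (y + v) \<and> adj (y + v) y \<and>
      {x + u, y + u} \<inter> {x + v, y + v} = {} \<and> {x, y} \<inter> {x + u, y + u, x + v, y + v} = {}"
    for x y u v
  have "\<forall>x y. adj x y \<longrightarrow> Q x y (1,0,0) (0,1,0) \<or> Q x y (1,0,0) (0,0,1) \<or> Q x y (0,1,0) (0,0,1)"
    unfolding vertex_all by (simp add: zero_prod_def adj_def Q_def)
  then have "\<exists>u v. Q x y u v" using assms by blast
  then show ?thesis using that unfolding Q_def by blast
qed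

text \<open>Connectedness phrased for invariants, so that it applies directly to functions constant
  along edges. The seven edges instantiated in the proof form a spanning tree.\<close>

lemma adj_connected:
  assumes "\<And>x y. adj x y \<Longrightarrow> f x = f y"
  shows "f x = f (y :: vertex)"
proof -
  have "\<forall>x. f x = f (0, 0, 0)"
    unfolding vertex_all
    using assms[of "(0,0,0)" "(0,0,1)"] assms[of "(0,0,0)" "(0,1,0)"] assms[of "(0,0,0)" "(1,0,0)"]
      assms[of "(0,0,1)" "(0,1,1)"] assms[of "(0,0,1)" "(1,0,1)"] assms[of "(0,1,0)" "(1,1,0)"]
      assms[of "(1,1,0)" "(1,1,1)"]
    by (simp add: zero_prod_def adj_def)
  then show ?thesis by metis
qed

text \<open>A missing edge can be bypassed along two faces, and a second missing edge disjoint from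
  it blocks at most one of the two detours.\<close>

lemma cube_minus_matching_connected:
  assumes disj: "{x, y} \<inter> {x', y'} = {}"
    and f: "\<And>u v. adj u v \<Longrightarrow> {u, v} \<noteq> {x, y} \<Longrightarrow> {u, v} \<noteq> {x', y'} \<Longrightarrow> f u = f v"
  shows "f u = f (v :: vertex)"
proof (rule adj_connected)
  \<comment> \<open>Stated for fresh pairs so that it serves both missing edges, with the pairs
    exchanged.\<close>
  have *: "f u = f v" if uv: "adj u v" and uvxy: "{u, v} = {x, y}" "{x, y} \<inter> {x', y'} = {}"
    and g: "\<And>u v. adj u v \<Longrightarrow> {u, v} \<noteq> {x, y} \<Longrightarrow> {u, v} \<noteq> {x', y'} \<Longrightarrow> f u = f v"
    for u v x y x' y'
  proof -
    obtain a b a' b' where ab: "adj u a" "adj a b" "adj b v" "adj u a'" "adj a' b'" "adj b' v"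
      "{a, b} \<inter> {a', b'} = {}" "{u, v} \<inter> {a, b, a', b'} = {}"
      using adj_two_detours[OF uv] by metis
    have out: "a \<notin> {x, y}" "b \<notin> {x, y}" "a' \<notin> {x, y}" "b' \<notin> {x, y}"
      using ab(8) unfolding uvxy(1) by auto
    have out': "u \<notin> {x', y'}" "v \<notin> {x', y'}"
      using uvxy by auto
    have step: "f p = f q" if "adj p q" "p \<notin> {x, y} \<or> q \<notin> {x, y}"
      "p \<notin> {x', y'} \<or> q \<notin> {x', y'}" for p q
      by (rule g[OF that(1)]) (use that(2,3) in auto)
    show ?thesis
    \<comment> \<open>Since \<open>u\<close> and \<open>v\<close> lie outside
      \<open>{x', y'}\<close>, that pair can only coincide with the middle edge of a detour; in that
      case the other detour is free.\<close>
    proof (cases "a \<in> {x', y'} \<and> b \<in> {x', y'}")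
      case False
      have "f u = f a" "f a = f b" "f b = f v"
        using step[OF ab(1)] step[OF ab(2)] step[OF ab(3)] out out' False by blast+
      then show ?thesis by simp
    next
      case True
      have "a \<noteq> b" using ab(2) by auto
      then have False': "a' \<notin> {x', y'}" using True ab(7) by auto
      have "f u = f a'" "f a' = f b'" "f b' = f v"
        using step[OF ab(4)] step[OF ab(5)] step[OF ab(6)] out out' False' by blast+
      then show ?thesis by simp
    qed
  qed
  fix u v assume uv: "adj u v"
  consider "{u, v} = {x, y}" | "{u, v} = {x', y'}" | "{u, v} \<noteq> {x, y}" "{u, v} \<noteq> {x', y'}" by blast
  then show "f u = f v"
  proof cases
    case 1 then show ?thesis using *[OF uv 1 disj f] by blast
  next
    case 2 then show ?thesis using *[OF uv 2 _ f] disj by blast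
  next
    case 3 then show ?thesis using f uv by blast
  qed
qed

section \<open>Orientations of the cube and the exchange of heads\<close>

lemma uedges_cube_iff: "Upair x y \<in> uedges cube \<longleftrightarrow> adj x y"
proof -
  have "adj u v \<longleftrightarrow> u - v \<in> {(1, 0, 0), (0, 1, 0), (0, 0, 1)}" for u v by (simp add: zero_prod_def adj_def)
  then have "uedges cube = {Upair u v | u v. adj u v}" unfolding cube_def by simp
  then have "Upair x y \<in> uedges cube \<longleftrightarrow> (\<exists>u v. (x = u \<and> y = v \<or> x = v \<and> y = u) \<and> adj u v)"
    by (simp del: split_paired_Ex)
  then show ?thesis using adj_sym by blast
qed

lemma orientation_cube:
  assumes "orientation_of D cube"
  shows "verts D = UNIV" "arcs D = uedges cube"
    "\<And>e. e \<in> arcs D \<Longrightarrow> e = Upair (tail D e) (head D e)"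
    "\<And>e. e \<in> arcs D \<Longrightarrow> adj (tail D e) (head D e)"
    "fin_digraph D"
proof -
  show v: "verts D = UNIV" and a: "arcs D = uedges cube"
    and e: "\<And>e. e \<in> arcs D \<Longrightarrow> e = Upair (tail D e) (head D e)"
    using assms by (auto simp: orientation_of_def cube_def)
  show "adj (tail D e) (head D e)" if "e \<in> arcs D" for e
    using that a e uedges_cube_iff by metis
  have "uedges cube \<subseteq> (\<lambda>(x, y). Upair x y) ` UNIV"
    by (auto simp: cube_def)
  then have "finite (arcs D)"
    using a finite_vertex by (simp add: finite_subset finite_Prod_UNIV)
  then show "fin_digraph D"
    by unfold_locales (auto simp: v finite_vertex)
qed

text \<open>Exchanging the heads of two arcs of the same color preserves all tiles, so the result is
  again a cube. This forces the two arcs to share an end, or to be opposite.\<close>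

lemma equal_colors_cube:
  fixes D :: "(vertex, vertex uprod) pre_digraph"
  assumes P: "three_realizes P cube" and D: "orientation_of D cube"
    and l: "edge_coloring D c l" and pot: "induced_pot D l \<subseteq> P"
    and e: "e \<in> arcs D" "e' \<in> arcs D" "l e = l e'"
  shows "tail D e = tail D e' \<or> head D e = head D e' \<or>
    tail D e' = antipode (head D e) \<and> head D e' = antipode (tail D e)"
proof (rule ccontr)
  assume neg: "\<not> ?thesis"
  note oD = orientation_cube[OF D]
  define \<sigma> where "\<sigma> a = (if a = e then e' else if a = e' then e else a)" for a
  define D' where "D' = D\<lparr>head := head D \<circ> \<sigma>\<rparr>"
  have \<sigma>\<sigma>: "\<sigma> (\<sigma> a) = a" and \<sigma>l: "l (\<sigma> a) = l a" for a
    using e by (auto simp: \<sigma>_def)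
  have \<sigma>arcs: "\<sigma> a \<in> arcs D \<longleftrightarrow> a \<in> arcs D" for a
    using e by (auto simp: \<sigma>_def)
  have inj: "inj \<sigma>" by (metis \<sigma>\<sigma> injI)
  have "tile_at D' l x = tile_at D l x" for x
  proof -
    have "{a \<in> arcs D. head D (\<sigma> a) = x} = \<sigma> ` {a \<in> arcs D. head D a = x}"
      using \<sigma>\<sigma> \<sigma>arcs by (auto intro!: image_eqI[where x = "\<sigma> _"])
    moreover have "mset_set (\<sigma> ` {a \<in> arcs D. head D a = x}) = image_mset \<sigma> (mset_set {a \<in> arcs D. head D a = x})"
      by (rule image_mset_mset_set[symmetric]) (use inj in \<open>auto intro: inj_on_subset\<close>)
    ultimately show ?thesis
      by (simp add: tile_at_def D'_def multiset.map_comp o_def \<sigma>l)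
  qed
  then have pot': "induced_pot D' l \<subseteq> P"
    using pot by (auto simp: induced_pot_def D'_def)
  have l': "edge_coloring D' c l" using l by (auto simp: edge_coloring_def D'_def)
  interpret D: fin_digraph D by (rule oD)
  have fin': "fin_digraph D'"
    by unfold_locales (auto simp: D'_def oD(1) finite_vertex)
  have "card (verts D') \<le> card (uverts cube)" "verts D' \<noteq> {}"
    by (simp_all add: D'_def oD(1) cube_def)
  then have "graph_iso (underlying D') cube"
    using three_realizes_underlying_iso[OF P fin' _ _ l' pot'] by blast
  then obtain f g where f: "bij_betw f UNIV (uverts cube)" and g: "bij_betw g (arcs D) (uedges cube)"
    and fg: "\<And>a. a \<in> arcs D \<Longrightarrow> g a = Upair (f (tail D a)) (f (head D (\<sigma> a)))"
    unfolding graph_iso_def underlying_def by (auto simp: D'_def oD(1) cube_def)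
  \<comment> \<open>The bipartition of the new cube, pulled back along the isomorphism to the old
    vertices.\<close>
  define h where "h = parity \<circ> f"
  have h: "h (tail D a) \<noteq> h (head D (\<sigma> a))" if "a \<in> arcs D" for a
    using fg[OF that] bij_betwE[OF g] that adj_parity uedges_cube_iff unfolding h_def o_def by metis
  have simple: "a = b" if "a \<in> arcs D" "b \<in> arcs D"
    "Upair (tail D a) (head D (\<sigma> a)) = Upair (tail D b) (head D (\<sigma> b))" for a b
  proof -
    have "g a = g b" using fg that by auto
    then show ?thesis using g that by (auto simp: bij_betw_def inj_on_eq_iff)
  qed
  define x y x' y' where "x = tail D e" "y = head D e" "x' = tail D e'" "y' = head D e'"
  note xy = this
  have \<sigma>e: "\<sigma> e = e'" "\<sigma> e' = e" and \<sigma>o: "\<And>a. a \<noteq> e \<Longrightarrow> a \<noteq> e' \<Longrightarrow> \<sigma> a = a"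
    by (auto simp: \<sigma>_def)
  have eU: "e = Upair x y" "e' = Upair x' y'" and ad: "adj x y" "adj x' y'"
    using oD(3,4) e by (auto simp: xy)
  have hh: "h x \<noteq> h y'" "h x' \<noteq> h y" using h[OF e(1)] h[OF e(2)] by (auto simp: \<sigma>e xy)
  have ne: "x \<noteq> x'" "y \<noteq> y'" using neg by (auto simp: xy)
  \<comment> \<open>The remaining coincidences \<open>x = y'\<close> and \<open>x' = y\<close> would
    turn an exchanged arc into a loop, which \<open>hh\<close> forbids.\<close>
  have disj: "{x, y} \<inter> {x', y'} = {}"
    using ne hh ad by auto
  have oth: "h u \<noteq> h v" if "adj u v" "{u, v} \<noteq> {x, y}" "{u, v} \<noteq> {x', y'}" for u v
  proof -
    let ?a = "Upair u v"
    have a: "?a \<in> arcs D" using that oD(2) uedges_cube_iff by blast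
    moreover have "?a \<noteq> e" "?a \<noteq> e'" using that(2,3) eU by (auto simp: doubleton_eq_iff)
    ultimately have "h (tail D ?a) \<noteq> h (head D ?a)" using h[OF a] \<sigma>o by simp
    then show ?thesis using oD(3)[OF a] by auto
  qed
  \<comment> \<open>Both bipartitions change along every edge other than the two exchanged ones, so
    their sum is invariant there; connectivity makes it constant.\<close>
  have "h u + parity u = h v + parity v" for u v
  proof (rule cube_minus_matching_connected[OF disj])
    fix u v assume "adj u v" "{u, v} \<noteq> {x, y}" "{u, v} \<noteq> {x', y'}"
    then have "h u \<noteq> h v" "parity u \<noteq> parity v" using oth adj_parity by blast+
    then show "h u + parity u = h v + parity v"
      using bit_cases[of "h u"] bit_cases[of "h v"] bit_cases[of "parity u"] bit_cases[of "parity v"]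
      by auto
  qed
  then have "parity u \<noteq> parity v" if "h u \<noteq> h v" for u v
    using that by (metis add_right_cancel)
  then have par: "parity x \<noteq> parity y'" "parity y \<noteq> parity x'" using hh by metis+
  \<comment> \<open>If the ends of a new arc were already adjacent, it would be parallel to an arc
    left in place, against \<open>simple\<close>.\<close>
  have nonadj: "\<not> adj x y'" "\<not> adj y x'"
  proof -
    have *: False if "adj u v" "{u, v} \<noteq> {x, y}" "{u, v} \<noteq> {x', y'}" "b \<in> {e, e'}"
      "Upair (tail D b) (head D (\<sigma> b)) = Upair u v" for u v b
    proof -
      let ?a = "Upair u v"
      have a: "?a \<in> arcs D" using that oD(2) uedges_cube_iff by blast
      moreover have ne: "?a \<noteq> e" "?a \<noteq> e'" using that(2,3) eU by (auto simp: doubleton_eq_iff)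
      moreover have "Upair (tail D ?a) (head D (\<sigma> ?a)) = ?a"
        using \<sigma>o[OF ne] oD(3)[OF a] by metis
      ultimately show False using simple[OF a, of b] that e by auto
    qed
    show "\<not> adj x y'" using *[of x y' e] ne disj by (auto simp: \<sigma>e xy doubleton_eq_iff)
    show "\<not> adj y x'" using *[of y x' e'] ne disj by (auto simp: \<sigma>e xy doubleton_eq_iff)
  qed
  have "y' = antipode x" "x' = antipode y"
    using parity_neq par nonadj by blast+
  then show False using neg by (simp add: xy)
qed

text \<open>Encodes orientation and coloring together as a skew-symmetric function on adjacent
  pairs: its value at \<open>x, y\<close> is what their edge contributes to the tile of
  \<open>x\<close>.\<close>

definition signed_color ::
    "(vertex, vertex uprod) pre_digraph \<Rightarrow> (vertex uprod \<Rightarrow> int) \<Rightarrow> vertex \<Rightarrow> vertex \<Rightarrow> int" where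
  "signed_color D l x y = (if tail D (Upair x y) = x then l (Upair x y) else - l (Upair x y))"

lemma Collect_adj:
  "{y. adj x y} = {x + (1,0,0), x + (0,1,0), x + (0,0,1)}"
proof -
  have "\<forall>x y. adj x y \<longleftrightarrow> y \<in> {x + (1,0,0), x + (0,1,0), x + (0,0,1)}"
    unfolding vertex_all by (simp add: zero_prod_def adj_def)
  then show ?thesis by blast
qed

lemma mset_set_partition:
  assumes "finite {y. Q y}"
  shows "mset_set {y. Q y} = mset_set {y. Q y \<and> R y} + mset_set {y. Q y \<and> \<not> R y}"
proof -
  have *: "{y. Q y} = {y. Q y \<and> R y} \<union> {y. Q y \<and> \<not> R y}" by blast
  have "finite {y. Q y \<and> R y}" "finite {y. Q y \<and> \<not> R y}"
    using assms by (auto intro: finite_subset)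
  then show ?thesis by (subst *, subst mset_set_Union) auto
qed

lemma tile_at_cube:
  assumes D: "orientation_of D cube"
  shows "tile_at D l x = image_mset (signed_color D l x) (mset_set {y. adj x y})"
proof -
  note oD = orientation_cube[OF D]
  interpret D: fin_digraph D by (rule oD)
  let ?T = "{y. adj x y \<and> tail D (Upair x y) = x}" and ?H = "{y. adj x y \<and> tail D (Upair x y) \<noteq> x}"
  have ends: "{tail D (Upair u v), head D (Upair u v)} = {u, v}" if "adj u v" for u v
    using oD(3)[of "Upair u v"] that oD(2) uedges_cube_iff by (metis set_uprod_simps)
  have inj: "inj_on (Upair x) A" for A by (auto simp: inj_on_def)
  have loopfree: "tail D e \<noteq> head D e" if "e \<in> arcs D" for e
    using oD(4)[OF that] by auto
  have T: "{e \<in> arcs D. tail D e = x} = Upair x ` ?T"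
  proof (intro equalityI subsetI)
    fix e assume e: "e \<in> {e \<in> arcs D. tail D e = x}"
    then have "e = Upair x (head D e)" "adj x (head D e)" using oD(3,4) by auto
    with e show "e \<in> Upair x ` ?T" by auto
  next
    fix e assume "e \<in> Upair x ` ?T"
    then obtain y where "e = Upair x y" "adj x y" "tail D e = x" by blast
    then show "e \<in> {e \<in> arcs D. tail D e = x}"
      using oD(2) uedges_cube_iff by blast
  qed
  have H: "{e \<in> arcs D. head D e = x} = Upair x ` ?H"
  proof (intro equalityI subsetI)
    fix e assume e: "e \<in> {e \<in> arcs D. head D e = x}"
    then have he: "e \<in> arcs D" "head D e = x" by auto
    have "e = Upair x (tail D e)" "adj x (tail D e)"
      using oD(3)[OF he(1)] oD(4)[OF he(1)] he(2) adj_sym by (metis Upair_inject)+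
    with e show "e \<in> Upair x ` ?H" using loopfree by auto
  next
    fix e assume "e \<in> Upair x ` ?H"
    then obtain y where "e = Upair x y" "adj x y" "tail D e \<noteq> x" by blast
    then show "e \<in> {e \<in> arcs D. head D e = x}"
      using ends[of x y] oD(2) uedges_cube_iff by (auto simp: doubleton_eq_iff)
  qed
  have "mset_set {y. adj x y} = mset_set ?T + mset_set ?H"
    by (rule mset_set_partition) (rule finite_vertex)
  then show ?thesis
    unfolding tile_at_def T H
    by (auto simp: image_mset_mset_set[OF inj, symmetric] multiset.map_comp o_def signed_color_def
        finite_vertex
        intro!: arg_cong2[where f = "(+)"] image_mset_cong)
qed

lemma signed_color_cube:
  assumes P: "three_realizes P cube" and D: "orientation_of D cube"
    and l: "edge_coloring D c l" and pot: "induced_pot D l \<subseteq> P"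
  defines "k \<equiv> signed_color D l"
  shows "\<And>x y. adj x y \<Longrightarrow> k y x = - k x y"
    "\<And>x y. adj x y \<Longrightarrow> k x y \<noteq> 0"
    "\<And>x y x' y'. adj x y \<Longrightarrow> adj x' y' \<Longrightarrow> k x y = k x' y' \<Longrightarrow>
      x = x' \<or> y = y' \<or> x' = antipode y \<and> y' = antipode x"
proof -
  note oD = orientation_cube[OF D]
  have arc: "Upair x y \<in> arcs D" if "adj x y" for x y
    using that oD(2) uedges_cube_iff by auto
  have ends: "tail D (Upair x y) = x \<and> head D (Upair x y) = y \<or>
      tail D (Upair x y) = y \<and> head D (Upair x y) = x" if "adj x y" for x y
    using oD(3)[OF arc[OF that]] by auto
  have pos: "l (Upair x y) > 0" if "adj x y" for x y
  proof -
    have "l (Upair x y) \<in> {1..int c}"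
      using l arc[OF that] unfolding edge_coloring_def by (rule funcset_mem)
    then show ?thesis by simp
  qed
  have comm: "Upair y x = Upair x y" for x y :: vertex by auto
  show skew: "k y x = - k x y" if "adj x y" for x y
    using ends[OF that] that unfolding k_def signed_color_def comm[of y x] by auto
  show nz: "k x y \<noteq> 0" if "adj x y" for x y
    using pos[OF that] unfolding k_def signed_color_def by auto
  \<comment> \<open>A positive value identifies the first argument as the tail, so the result on
    arcs of equal color applies. Negative values follow by reversing both pairs.\<close>
  have *: "x = x' \<or> y = y' \<or> x' = antipode y \<and> y' = antipode x"
    if a: "adj x y" "adj x' y'" "k x y = k x' y'" and "k x y > 0" for x y x' y'
  proof -
    have t: "tail D (Upair x y) = x" "tail D (Upair x' y') = x'"
      using that pos[OF a(1)] pos[OF a(2)] unfolding k_def signed_color_def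
      by (auto split: if_splits)
    then have "head D (Upair x y) = y" "head D (Upair x' y') = y'"
      using ends a by fastforce+
    moreover have "l (Upair x y) = l (Upair x' y')"
      using a(3) t unfolding k_def signed_color_def by simp
    ultimately show ?thesis
      using equal_colors_cube[OF P D l pot arc[OF a(1)] arc[OF a(2)]] t by simp
  qed
  show "x = x' \<or> y = y' \<or> x' = antipode y \<and> y' = antipode x"
    if a: "adj x y" "adj x' y'" "k x y = k x' y'" for x y x' y'
  proof (cases "k x y > 0")
    case True then show ?thesis using * a by blast
  next
    case False
    have "k y x > 0" "k y x = k y' x'" using False nz[OF a(1)] skew[OF a(1)] skew[OF a(2)] a(3) by auto
    then have "y = y' \<or> x = x' \<or> y' = antipode x \<and> x' = antipode y"
      using * a adj_sym by metis
    then show ?thesis by blast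
  qed
qed

section \<open>Pairs of equal tiles\<close>

text \<open>The cycle \<open>x p y q\<close> bounds a face, and \<open>r p' s q'\<close> are the neighbors of \<open>x, p, y, q\<close> on the
  opposite face. The vertex type is kept abstract so that simplification does not split
  vertices into coordinates.\<close>

definition frame_wrt :: "('v \<Rightarrow> 'v \<Rightarrow> bool) \<Rightarrow> ('v \<Rightarrow> 'v) \<Rightarrow>
    'v \<Rightarrow> 'v \<Rightarrow> 'v \<Rightarrow> 'v \<Rightarrow> 'v \<Rightarrow> 'v \<Rightarrow> 'v \<Rightarrow> 'v \<Rightarrow> bool" where
  "frame_wrt E a x y p q r s p' q' \<longleftrightarrow>
     card (UNIV :: 'v set) = 8 \<and> UNIV = {x, y, p, q, r, s, p', q'} \<and>
     Collect (E x) = {p, q, r} \<and> Collect (E y) = {p, q, s} \<and>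
     Collect (E p) = {x, y, p'} \<and> Collect (E q) = {x, y, q'} \<and>
     Collect (E r) = {x, p', q'} \<and> Collect (E s) = {y, p', q'} \<and>
     Collect (E p') = {p, r, s} \<and> Collect (E q') = {q, r, s} \<and>
     a x = s \<and> a s = x \<and> a y = r \<and> a r = y \<and>
     a p = q' \<and> a q' = p \<and> a q = p' \<and> a p' = q"

text \<open>Cube symmetries acting on the eight names: two reflections of the face, passage to the
  face with diagonal \<open>x, p'\<close>, and passage to the opposite face. They transfer each
  argument to its symmetric cases.\<close>

lemma frame_wrt_swap:
  assumes "frame_wrt E a x y p q r s p' q'"
  shows "frame_wrt E a y x p q s r p' q'" "frame_wrt E a x y q p r s q' p'"
    "frame_wrt E a x p' p r q s y q'" "frame_wrt E a r s p' q' x y p q"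
  using assms unfolding frame_wrt_def by (simp_all add: insert_commute)

text \<open>Eight names that exhaust a type of eight elements cannot repeat; this is the purpose of
  the cardinality in \<open>frame_wrt\<close>.\<close>

lemma frame_wrt_distinct:
  assumes "frame_wrt E a x y p q r s p' q'"
  shows "distinct [x, y, p, q, r, s, p', q']"
proof (rule card_distinct)
  have "set [x, y, p, q, r, s, p', q'] = UNIV" "card (UNIV :: 'a set) = 8"
    using assms unfolding frame_wrt_def by auto
  then show "card (set [x, y, p, q, r, s, p', q']) = length [x, y, p, q, r, s, p', q']"
    by (simp only:) simp
qed

lemma frame_wrt_adj:
  assumes "frame_wrt E a x y p q r s p' q'"
  shows "E x p" "E x q" "E x r" "E y p" "E y q" "E y s"
    "E p x" "E p y" "E p p'" "E q x" "E q y" "E q q'"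
    "E r x" "E r p'" "E r q'" "E s y" "E s p'" "E s q'"
    "E p' p" "E p' r" "E p' s" "E q' q" "E q' r" "E q' s"
proof -
  have *: "E u v" if "Collect (E u) = A" "v \<in> A" for u v A
    using that by blast
  show "E x p" "E x q" "E x r" "E y p" "E y q" "E y s"
    "E p x" "E p y" "E p p'" "E q x" "E q y" "E q q'"
    "E r x" "E r p'" "E r q'" "E s y" "E s p'" "E s q'"
    "E p' p" "E p' r" "E p' s" "E q' q" "E q' r" "E q' s"
    using assms unfolding frame_wrt_def by - (elim conjE; erule *; simp)+
qed

abbreviation frame where "frame \<equiv> frame_wrt adj antipode"

lemmas frame_swap = frame_wrt_swap[where E = adj and a = antipode]

lemmas frame_adj = frame_wrt_adj[where E = adj and a = antipode]

lemmas frame_distinct = frame_wrt_distinct[where E = adj and a = antipode]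

lemmas frame_def = frame_wrt_def[where E = adj and a = antipode]

lemma frame_exists:
  assumes "x \<noteq> y" "parity x = parity y"
  obtains p q r s p' q' where "frame x y p q r s p' q'"
proof -
  \<comment> \<open>Distinct vertices of equal parity differ in exactly two directions
    \<open>u, v\<close>, which span their common face; \<open>w\<close> is the third direction and
    leads to the opposite face.\<close>
  define Q where "Q x u v w \<longleftrightarrow>
    frame x (x + u + v) (x + u) (x + v) (x + w) (x + u + v + w) (x + u + w) (x + v + w)" for x u v w
  have "\<forall>x. Q x (1,0,0) (0,1,0) (0,0,1)" "\<forall>x. Q x (1,0,0) (0,0,1) (0,1,0)"
    "\<forall>x. Q x (0,1,0) (0,0,1) (1,0,0)"
    unfolding vertex_all by (simp_all add: Q_def frame_def Collect_adj antipode_def UNIV_vertex insert_commute)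
  moreover have "\<forall>x y. x \<noteq> y \<longrightarrow> parity x = parity y \<longrightarrow>
      y = x + (1,0,0) + (0,1,0) \<or> y = x + (1,0,0) + (0,0,1) \<or> y = x + (0,1,0) + (0,0,1)"
    unfolding vertex_all by (simp add: parity_def)
  ultimately show ?thesis
    using that assms unfolding Q_def by metis
qed

text \<open>The combinatorial trace of 3-realizability from which the coloring is classified. As
  values are signed, sharing the first or the second argument means sharing tails or sharing
  heads.\<close>

definition star_colored :: "(vertex \<Rightarrow> vertex \<Rightarrow> int) \<Rightarrow> bool" where
  "star_colored k \<longleftrightarrow>
     (\<forall>x y. adj x y \<longrightarrow> k y x = - k x y \<and> k x y \<noteq> 0) \<and>
     (\<forall>x y x' y'. adj x y \<longrightarrow> adj x' y' \<longrightarrow> k x y = k x' y' \<longrightarrow>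
        x = x' \<or> y = y' \<or> x' = antipode y \<and> y' = antipode x)"

definition vertex_tile :: "(vertex \<Rightarrow> vertex \<Rightarrow> int) \<Rightarrow> vertex \<Rightarrow> int multiset" where
  "vertex_tile k x = image_mset (k x) (mset_set {y. adj x y})"

lemma frame_tiles:
  assumes "frame x y p q r s p' q'"
  shows "vertex_tile k x = {#k x p, k x q, k x r#}"
    "vertex_tile k y = {#k y p, k y q, k y s#}"
    "vertex_tile k p = {#k p x, k p y, k p p'#}"
    "vertex_tile k q = {#k q x, k q y, k q q'#}"
    "vertex_tile k r = {#k r x, k r p', k r q'#}"
    "vertex_tile k s = {#k s y, k s p', k s q'#}"
    "vertex_tile k p' = {#k p' p, k p' r, k p' s#}"
    "vertex_tile k q' = {#k q' q, k q' r, k q' s#}"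
  using frame_distinct[OF assms] assms unfolding frame_def vertex_tile_def by simp_all

lemma star_conflict:
  assumes "star_colored k" "adj x y" "adj x' y'" "x \<noteq> x'" "y \<noteq> y'"
    "x' \<noteq> antipode y \<or> y' \<noteq> antipode x"
  shows "k x y \<noteq> k x' y'"
  using assms unfolding star_colored_def by blast

text \<open>A value at an edge from \<open>x\<close> to \<open>p\<close> recurs at some edge from
  \<open>y\<close>. For distinct \<open>x, y\<close> the star condition makes \<open>y\<close> a
  neighbor or the antipode of \<open>p\<close>, and both have the parity of
  \<open>x\<close>.\<close>

lemma tile_eq_parity:
  assumes k: "star_colored k" and eq: "vertex_tile k x = vertex_tile k y"
  shows "parity x = parity y"
proof (cases "x = y")
  case False
  obtain p where p: "adj x p" using Collect_adj[of x] by blast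
  then have "k x p \<in># vertex_tile k x" by (simp add: vertex_tile_def finite_vertex)
  then obtain z where z: "adj y z" "k x p = k y z"
    unfolding eq by (auto simp: vertex_tile_def finite_vertex)
  have anti: "parity (antipode v) \<noteq> parity v" for v
  proof -
    have "\<forall>v. parity (antipode v) \<noteq> parity v"
      unfolding vertex_all by (simp add: parity_def antipode_def)
    then show ?thesis by blast
  qed
  have two: "b = c" if "a \<noteq> b" "a \<noteq> c" for a b c :: bit
    using that bit_cases by metis
  have "p = z \<or> y = antipode p"
    using star_conflict[OF k p z(1)] False z(2) by blast
  then have "parity p \<noteq> parity y" using anti adj_parity[OF z(1)] by metis
  then show ?thesis using adj_parity[OF p] two by metis
qed simp

text \<open>Equal multisets could match in any order, but all matchings except the one by common
  neighbors pair edges that are in conflict.\<close>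

lemma tile_eq_frame:
  assumes k: "star_colored k" and eq: "vertex_tile k x = vertex_tile k y"
    and fr: "frame x y p q r s p' q'"
  shows "k x p = k y p" "k x q = k y q" "k x r = k y s"
proof -
  note ad = frame_adj[OF fr]
  have ne: "x \<noteq> y" "p \<noteq> q" "p \<noteq> s" "q \<noteq> s" "y \<noteq> antipode p" "y \<noteq> antipode q"
    using frame_distinct[OF fr] fr unfolding frame_def by auto
  have c: "k x p \<noteq> k y q" "k x p \<noteq> k y s" "k x q \<noteq> k y p" "k x q \<noteq> k y s"
    by (rule star_conflict[OF k]; use ne ad in simp)+
  have m: "{#k x p, k x q, k x r#} = {#k y p, k y q, k y s#}"
    using eq frame_tiles[OF fr] by metis
  have "k x p \<in># {#k y p, k y q, k y s#}" "k x q \<in># {#k y p, k y q, k y s#}"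
    unfolding m[symmetric] by auto
  then show 1: "k x p = k y p" "k x q = k y q" using c by auto
  show "k x r = k y s" using m unfolding 1 by simp
qed

text \<open>By parity a third vertex would be \<open>p'\<close> or \<open>q'\<close>. If it is
  \<open>p'\<close>, matching its tile with those of \<open>x\<close> and \<open>y\<close> gives the
  edges \<open>x q\<close> and \<open>y s\<close> equal values, a conflict; the other case is
  symmetric.\<close>

lemma no_three_equal_tiles:
  assumes k: "star_colored k" and eq: "vertex_tile k x = vertex_tile k y"
    "vertex_tile k x = vertex_tile k z" and ne: "x \<noteq> y" "x \<noteq> z" "y \<noteq> z"
  shows False
proof -
  obtain p q r s p' q' where fr: "frame x y p q r s p' q'"
    using frame_exists[OF ne(1) tile_eq_parity[OF k eq(1)]] .
  have main: False if fr: "frame x y p q r s z q'" for p q r s q'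
  proof -
    note sw = frame_swap(3)[OF fr]
    have 1: "k x q = k z s" using tile_eq_frame(3)[OF k eq(2) sw] .
    have 2: "k y s = k z s"
      using tile_eq_frame(2)[OF k _ frame_swap(3)[OF frame_swap(1)[OF fr]]] eq by simp
    have "y \<noteq> antipode q" "q \<noteq> s" using frame_distinct[OF fr] fr unfolding frame_def by auto
    then have "k x q \<noteq> k y s"
      using frame_adj[OF fr] ne by (intro star_conflict[OF k]) auto
    then show False using 1 2 by simp
  qed
  have "parity z = parity x" using tile_eq_parity[OF k eq(2)] by simp
  then have "\<not> adj x z" "\<not> adj y z" using adj_parity tile_eq_parity[OF k eq(1)] by metis+
  moreover have "z \<in> {x, y, p, q, r, s, p', q'}" using fr unfolding frame_def by blast
  ultimately have "z = p' \<or> z = q'" using ne frame_adj[OF fr] by auto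
  then show False
    using main[of p q r s q'] main[of q p r s p'] fr frame_swap(2)[OF fr] by blast
qed

text \<open>The pigeonhole principle twice: after deleting \<open>x\<close>, seven vertices still
  share at most six tiles. The absence of triples makes the second pair disjoint from the
  first.\<close>

lemma two_pairs_of_equal_tiles:
  assumes k: "star_colored k" and card: "card (range (vertex_tile k)) \<le> 6"
  obtains x y x' y' where "x \<noteq> y" "vertex_tile k x = vertex_tile k y"
    "x' \<noteq> y'" "vertex_tile k x' = vertex_tile k y'" "{x, y} \<inter> {x', y'} = {}"
proof -
  let ?t = "vertex_tile k"
  have 8: "card (UNIV :: vertex set) = 8" by (simp add: UNIV_vertex)
  have "\<not> inj ?t" using card 8 card_image[of ?t UNIV] by auto
  then obtain x y where xy: "x \<noteq> y" "?t x = ?t y" unfolding inj_def by blast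
  have "card (?t ` (UNIV - {x})) \<le> 6"
    using card card_mono[OF finite_imageI[OF finite_vertex], of "?t ` (UNIV - {x})" ?t UNIV]
    by (simp add: image_mono)
  moreover have "card (UNIV - {x}) = 7" using 8 by (simp add: finite_vertex)
  ultimately have "\<not> inj_on ?t (UNIV - {x})" using card_image[of ?t "UNIV - {x}"] by auto
  then obtain x' y' where xy': "x' \<noteq> y'" "?t x' = ?t y'" "x' \<noteq> x" "y' \<noteq> x"
    unfolding inj_on_def by blast
  have "x' \<noteq> y" "y' \<noteq> y"
    using no_three_equal_tiles[OF k, of x y y'] no_three_equal_tiles[OF k, of x y x'] xy xy' by metis+
  then show ?thesis using that[of x y x' y'] xy xy' by blast
qed

text \<open>Both directions of the second edge conflict with the first edge, which excludes equal as
  well as opposite values.\<close>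

lemma star_conflict_abs:
  assumes k: "star_colored k" and ad: "adj x y" "adj x' y'"
    and "x \<noteq> x' \<and> y \<noteq> y' \<and> (x' \<noteq> antipode y \<or> y' \<noteq> antipode x)"
    and "x \<noteq> y' \<and> y \<noteq> x' \<and> (y' \<noteq> antipode y \<or> x' \<noteq> antipode x)"
  shows "\<bar>k x y\<bar> \<noteq> \<bar>k x' y'\<bar>"
proof -
  have "k y' x' = - k x' y'" using k ad(2) unfolding star_colored_def by blast
  moreover have "k x y \<noteq> k x' y'" using assms by (intro star_conflict[OF k]) auto
  moreover have "k x y \<noteq> k y' x'"
    using assms adj_sym[of x' y'] by (intro star_conflict[OF k]) auto
  ultimately show ?thesis by (auto simp: abs_eq_iff)
qed

lemma frame_exhaust:
  assumes "frame x y p q r s p' q'"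
  shows "w \<in> {x, y, p, q, r, s, p', q'}"
proof -
  have "UNIV = {x, y, p, q, r, s, p', q'}" using assms unfolding frame_def by (elim conjE)
  then show ?thesis using UNIV_I by metis
qed

lemma frame_neq:
  assumes "frame x y p q r s p' q'"
  shows "distinct [x, y, p, q, r, s, p', q']" "distinct [q', p', s, r, q, p, y, x]"
  using frame_distinct[OF assms] by auto

lemma frame_antipode:
  assumes "frame x y p q r s p' q'"
  shows "antipode x = s" "antipode s = x" "antipode y = r" "antipode r = y"
    "antipode p = q'" "antipode q' = p" "antipode q = p'" "antipode p' = q"
  using assms unfolding frame_def by auto

definition abs_colors :: "(vertex \<Rightarrow> vertex \<Rightarrow> int) \<Rightarrow> int set" where
  "abs_colors k = (\<Union>u. (\<lambda>v. \<bar>k u v\<bar>) ` {v. adj u v})"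

lemma abs_colorsI: "adj u v \<Longrightarrow> \<bar>k u v\<bar> \<in> abs_colors k"
  unfolding abs_colors_def by blast

lemma finite_abs_colors: "finite (abs_colors k)"
  unfolding abs_colors_def by (intro finite_UN_I finite_imageI finite_vertex)

text \<open>In the extreme case the listed colors are the whole palette, so every further edge must
  reuse one of them.\<close>

lemma abs_colors_length:
  assumes "card (abs_colors k) \<le> n" "distinct cs"
    "set cs \<subseteq> (abs_colors k)"
  shows "length cs \<le> n" "length cs = n \<Longrightarrow> adj a b \<Longrightarrow> \<bar>k a b\<bar> \<in> set cs"
proof -
  have *: "length cs = card (set cs)" using assms(2) by (simp add: distinct_card)
  then show "length cs \<le> n" using assms card_mono[OF finite_abs_colors assms(3)] by simp
  assume "length cs = n" "adj a b"
  then have "set cs = (abs_colors k)"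
    using * assms(1) by (intro card_seteq[OF finite_abs_colors assms(3)]) simp
  then show "\<bar>k a b\<bar> \<in> set cs" using \<open>adj a b\<close> abs_colorsI by simp
qed

text \<open>In each case the two pairs force edges of the same color that are in conflict, except that
  the pair \<open>p', q'\<close> would lead to six different colors.\<close>

lemma second_pair_opposite:
  assumes k: "star_colored k" and card: "card (abs_colors k) \<le> 5"
    and fr: "frame x y p q r s p' q'" and xy: "vertex_tile k x = vertex_tile k y"
    and uv: "u \<noteq> v" "vertex_tile k u = vertex_tile k v" "{x, y} \<inter> {u, v} = {}"
  shows "{u, v} = {r, s}"
proof -
  have skew: "k v u = - k u v" if "adj u v" for u v
    using k that unfolding star_colored_def by blast
  have pq: False if fr: "frame x y p q r s p' q'" and eq: "vertex_tile k p = vertex_tile k q"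
    and xy: "vertex_tile k x = vertex_tile k y" for x y p q r s p' q'
  proof -
    note ad = frame_adj[OF fr] and ne = frame_neq[OF fr] and an = frame_antipode[OF fr]
    have fr': "frame p q x y p' q' r s"
      using fr ne unfolding frame_def by (simp add: insert_commute)
    have "k p x = k p y"
      using tile_eq_frame(1)[OF k xy fr] skew[OF ad(1)] skew[OF ad(4)] by simp
    moreover have "k p x = k q x" using tile_eq_frame(1)[OF k eq fr'] .
    moreover have "k q x \<noteq> k p y"
      by (rule star_conflict[OF k]; use ad ne an in simp)
    ultimately show False by simp
  qed
  have pr: False if fr: "frame x y p q r s p' q'" and eq: "vertex_tile k p = vertex_tile k r"
    and xy: "vertex_tile k x = vertex_tile k y" for x y p q r s p' q'
  proof -
    note ad = frame_adj[OF fr] and ne = frame_neq[OF fr] and an = frame_antipode[OF fr]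
    have fr': "frame p r x p' y q' q s"
      using fr ne unfolding frame_def by (simp add: insert_commute)
    have "k p x = k p y"
      using tile_eq_frame(1)[OF k xy fr] skew[OF ad(1)] skew[OF ad(4)] by simp
    moreover have "k p x = k r x" using tile_eq_frame(1)[OF k eq fr'] .
    moreover have "k r x \<noteq> k p y"
      by (rule star_conflict[OF k]; use ad ne an in simp)
    ultimately show False by simp
  qed
  have p'q': False if eq: "vertex_tile k p' = vertex_tile k q'"
  proof -
    note ad = frame_adj[OF fr] and ne = frame_neq[OF fr] and an = frame_antipode[OF fr]
    have fr': "frame p' q' r s p q x y"
      using fr ne unfolding frame_def by (simp add: insert_commute)
    note 1 = tile_eq_frame[OF k xy fr] and 2 = tile_eq_frame[OF k eq fr']
    let ?cs = "[\<bar>k x p\<bar>, \<bar>k x q\<bar>, \<bar>k x r\<bar>, \<bar>k p' p\<bar>, \<bar>k p' r\<bar>, \<bar>k p' s\<bar>]"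
    \<comment> \<open>Edges with a common end need not conflict. Each pair of colors is therefore
      tested on other edges that have these colors by \<open>1\<close> and \<open>2\<close>, for
      instance \<open>y q\<close> in place of \<open>x q\<close>.\<close>
    have "\<bar>k x p\<bar> \<noteq> \<bar>k y q\<bar>" "\<bar>k x p\<bar> \<noteq> \<bar>k y s\<bar>" "\<bar>k x p\<bar> \<noteq> \<bar>k q' q\<bar>" "\<bar>k x p\<bar> \<noteq> \<bar>k p' r\<bar>"
      "\<bar>k y p\<bar> \<noteq> \<bar>k p' s\<bar>" "\<bar>k x q\<bar> \<noteq> \<bar>k y s\<bar>" "\<bar>k x q\<bar> \<noteq> \<bar>k p' p\<bar>" "\<bar>k x q\<bar> \<noteq> \<bar>k q' r\<bar>"
      "\<bar>k y q\<bar> \<noteq> \<bar>k q' s\<bar>" "\<bar>k x r\<bar> \<noteq> \<bar>k p' p\<bar>" "\<bar>k y s\<bar> \<noteq> \<bar>k p' r\<bar>" "\<bar>k x r\<bar> \<noteq> \<bar>k p' s\<bar>"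
      "\<bar>k q' q\<bar> \<noteq> \<bar>k p' r\<bar>" "\<bar>k q' q\<bar> \<noteq> \<bar>k p' s\<bar>" "\<bar>k p' r\<bar> \<noteq> \<bar>k q' s\<bar>"
      by (rule star_conflict_abs[OF k]; use ad ne an in simp)+
    then have "distinct ?cs" unfolding 1[symmetric] 2[symmetric] by simp
    moreover have "set ?cs \<subseteq> (abs_colors k)" using ad by (simp add: abs_colorsI)
    ultimately have "length ?cs \<le> 5" by (rule abs_colors_length(1)[OF card])
    then show False by simp
  qed
  have qs: False if eq: "vertex_tile k q = vertex_tile k s" using pr[OF frame_swap(1)[OF frame_swap(2)[OF fr]] eq] xy by simp
  have ps: False if eq: "vertex_tile k p = vertex_tile k s" using pr[OF frame_swap(1)[OF fr] eq] xy by simp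
  have qr: False if eq: "vertex_tile k q = vertex_tile k r" using pr[OF frame_swap(2)[OF fr] eq] xy by simp
  have *: "{u, v} = {r, s}" if "u \<in> {p, q, r, s}" "v \<in> {p, q, r, s}"
    using that uv(1,2) pq[OF fr] pr[OF fr] qs ps qr xy by auto
  \<comment> \<open>The bipartition confines \<open>u, v\<close> to \<open>p, q, r, s\<close> or to
    \<open>p', q'\<close>, because the other class consists of \<open>x, y, p', q'\<close>.\<close>
  have par: "parity p = parity q" "parity p = parity r" "parity p = parity s" "parity p' = parity q'"
    "parity p \<noteq> parity p'"
    using adj_parity bit_cases frame_adj[OF fr] by metis+
  have "parity u = parity v" using tile_eq_parity[OF k uv(2)] .
  moreover have "u \<in> {p, q, r, s, p', q'}" "v \<in> {p, q, r, s, p', q'}"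
    using frame_exhaust[OF fr, of u] frame_exhaust[OF fr, of v] uv(3) by auto
  ultimately have "u \<in> {p, q, r, s} \<and> v \<in> {p, q, r, s} \<or> u \<in> {p', q'} \<and> v \<in> {p', q'}"
    using par by auto
  then show ?thesis using * p'q' uv(1,2) by auto
qed

text \<open>The five colors exhaust the palette, and conflicts leave the edge \<open>p p'\<close>
  only those of \<open>x p\<close> and \<open>r p'\<close>. The star condition then fixes its sign
  in either case.\<close>

lemma frame_colors:
  assumes k: "star_colored k" and card: "card (abs_colors k) \<le> 5"
    and fr: "frame x y p q r s p' q'" and xy: "vertex_tile k x = vertex_tile k y"
    and rs: "vertex_tile k r = vertex_tile k s"
  shows "distinct [\<bar>k x p\<bar>, \<bar>k x q\<bar>, \<bar>k x r\<bar>, \<bar>k r p'\<bar>, \<bar>k r q'\<bar>]"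
    and "k p p' = k p x \<or> k p' p = k p' r"
proof -
  have skew: "k v u = - k u v" if "adj u v" for u v
    using k that unfolding star_colored_def by blast
  note ad = frame_adj[OF fr] and ne = frame_neq[OF fr] and an = frame_antipode[OF fr]
  note 1 = tile_eq_frame[OF k xy fr] and 2 = tile_eq_frame(1,2)[OF k rs frame_swap(4)[OF fr]]
  let ?cs = "[\<bar>k x p\<bar>, \<bar>k x q\<bar>, \<bar>k x r\<bar>, \<bar>k r p'\<bar>, \<bar>k r q'\<bar>]"
  have "\<bar>k x p\<bar> \<noteq> \<bar>k y q\<bar>" "\<bar>k x p\<bar> \<noteq> \<bar>k y s\<bar>" "\<bar>k x p\<bar> \<noteq> \<bar>k r p'\<bar>" "\<bar>k x p\<bar> \<noteq> \<bar>k r q'\<bar>"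
    "\<bar>k x q\<bar> \<noteq> \<bar>k y s\<bar>" "\<bar>k x q\<bar> \<noteq> \<bar>k r p'\<bar>" "\<bar>k x q\<bar> \<noteq> \<bar>k r q'\<bar>"
    "\<bar>k x r\<bar> \<noteq> \<bar>k s p'\<bar>" "\<bar>k x r\<bar> \<noteq> \<bar>k s q'\<bar>" "\<bar>k r p'\<bar> \<noteq> \<bar>k s q'\<bar>"
    by (rule star_conflict_abs[OF k]; use ad ne an in simp)+
  then show d: "distinct ?cs" unfolding 1[symmetric] 2[symmetric] by simp
  have "set ?cs \<subseteq> (abs_colors k)" using ad by (simp add: abs_colorsI)
  then have "\<bar>k p p'\<bar> \<in> set ?cs"
    using abs_colors_length(2)[OF card d _ _ ad(9)] by simp
  moreover have "\<bar>k p p'\<bar> \<noteq> \<bar>k x q\<bar>" "\<bar>k p p'\<bar> \<noteq> \<bar>k x r\<bar>" "\<bar>k p p'\<bar> \<noteq> \<bar>k r q'\<bar>"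
    by (rule star_conflict_abs[OF k]; use ad ne an in simp)+
  ultimately have "\<bar>k p p'\<bar> = \<bar>k x p\<bar> \<or> \<bar>k p p'\<bar> = \<bar>k r p'\<bar>" by simp
  moreover have "k p' p \<noteq> k p x" "k p p' \<noteq> k p' r"
    by (rule star_conflict[OF k]; use ad ne an in simp)+
  ultimately show "k p p' = k p x \<or> k p' p = k p' r"
    using skew[OF ad(9)] skew[OF ad(1)] skew[OF ad(14)] by (auto simp: abs_eq_iff)
qed

section \<open>Pot isomorphisms\<close>

definition elements :: "pot \<Rightarrow> int set" where
  "elements P = (\<Union>t\<in>P. set_mset t)"

text \<open>\<open>colors\<close> records only positive entries; closure under negation makes the
  signed colors coincide with the entries of the tiles.\<close>

lemma signed_colors:
  assumes "0 \<notin> elements P" "\<And>i. i \<in> elements P \<Longrightarrow> - i \<in> elements P"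
  shows "signed (colors P) = elements P"
proof -
  have "colors P = {i \<in> elements P. i > 0}" by (auto simp: colors_def elements_def)
  moreover have "i \<in> uminus ` {i \<in> elements P. i > 0}" if "i \<in> elements P" "\<not> i > 0" for i
    using that assms by (intro image_eqI[of _ _ "- i"]) (auto simp: order.order_iff_strict not_less)
  ultimately show ?thesis using assms(2) by (auto simp: signed_def)
qed

text \<open>Allows an isomorphism to be found as a substitution into a standard pot; the required
  map goes the other way and is its inverse.\<close>

lemma pot_iso_image:
  assumes "0 \<notin> elements P" and neg: "\<And>i. i \<in> elements P \<Longrightarrow> - i \<in> elements P"
    and odd: "\<And>i. i \<in> elements P \<Longrightarrow> g (- i) = - g i" and inj: "inj_on g (elements P)"
  shows "pot_iso (image_mset g ` P) P"
proof -
  let ?P = "image_mset g ` P"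
  have el: "elements ?P = g ` elements P" by (auto simp: elements_def)
  have "g i \<noteq> 0" if "i \<in> elements P" for i
  proof
    assume "g i = 0"
    then have "g (- i) = g i" using odd[OF that] by simp
    then have "- i = i" using inj_onD[OF inj] that neg[OF that] by blast
    then show False using that assms(1) by auto
  qed
  then have "0 \<notin> elements ?P" unfolding el by force
  moreover have "- j \<in> elements ?P" if "j \<in> elements ?P" for j
  proof -
    from that obtain i where i: "i \<in> elements P" "j = g i" unfolding el by blast
    then have "- j = g (- i)" using odd by simp
    then show ?thesis using neg[OF i(1)] unfolding el by blast
  qed
  ultimately have s': "signed (colors ?P) = g ` elements P"
    using signed_colors[of ?P] unfolding el by blast
  have s: "signed (colors P) = elements P"
    using signed_colors assms(1) neg by blast
  define f where "f = inv_into (elements P) g"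
  have fg: "f (g i) = i" if "i \<in> elements P" for i
    using that inj by (simp add: f_def)
  have "bij_betw f (g ` elements P) (elements P)"
    using inj by (simp add: f_def bij_betw_inv_into inj_on_imp_bij_betw)
  moreover have "f (- i) = - f i" if "i \<in> g ` elements P" for i
  proof -
    from that obtain j where "j \<in> elements P" "i = g j" by blast
    then show ?thesis using fg[of j] fg[of "- j"] neg[of j] odd[of j] by simp
  qed
  moreover have "image_mset f (image_mset g t) = t" if "t \<in> P" for t
  proof -
    have "image_mset (f \<circ> g) t = image_mset id t"
      by (rule image_mset_cong) (use that fg in \<open>auto simp: elements_def\<close>)
    then show ?thesis by (simp add: multiset.map_comp)
  qed
  then have "image_mset f ` ?P = P" by (force simp: image_image)
  moreover have "\<forall>t\<in>?P. set_mset t \<subseteq> g ` elements P" by (auto simp: elements_def)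
  ultimately show ?thesis unfolding pot_iso_def s s' by blast
qed

abbreviation P1 :: pot where
  "P1 \<equiv> {{#1, 1, 1#}, {#2, 2, 2#}, {#-2, -3, -3#}, {#-1, -4, -4#}, {#-1, 3, -5#}, {#-2, 4, 5#}}"

abbreviation P2 :: pot where
  "P2 \<equiv> {{#1, 1, 1#}, {#2, 2, 2#}, {#-2, -3, -3#}, {#-1, -4, -4#}, {#3, 4, 5#}, {#-1, -2, -5#}}"

text \<open>The odd extension of a list whose entries are counted from one. Its value at
  \<open>0\<close> is the stray \<open>- (cs ! 0)\<close>, and \<open>0\<close> is not an entry of
  the pots considered.\<close>

definition odd_map :: "int list \<Rightarrow> int \<Rightarrow> int" where
  "odd_map cs i = (if i > 0 then cs ! nat (i - 1) else - (cs ! nat (- i - 1)))"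

lemma odd_map:
  assumes "distinct (map abs cs)" "0 \<notin> set cs" "length cs = 5"
    and el: "elements P = {-5, -4, -3, -2, -1, 1, 2, 3, 4, 5}"
  shows "pot_iso (image_mset (odd_map cs) ` P) P"
proof (rule pot_iso_image)
  have el': "i \<in> elements P \<longleftrightarrow> i \<noteq> 0 \<and> \<bar>i\<bar> \<le> 5" for i
    unfolding el by (simp, arith)
  show odd: "odd_map cs (- i) = - odd_map cs i" if "i \<in> elements P" for i
    using that unfolding el' odd_map_def by auto
  have abs: "\<bar>odd_map cs i\<bar> = map abs cs ! (nat \<bar>i\<bar> - 1)" "nat \<bar>i\<bar> - 1 < length (map abs cs)"
    if "i \<in> elements P" for i
    using that assms(3) unfolding el' odd_map_def by (auto simp: nat_diff_distrib)
  have nz: "odd_map cs i \<noteq> 0" if "i \<in> elements P" for i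
  proof -
    have "\<bar>odd_map cs i\<bar> \<in> set (map abs cs)"
      using abs[OF that] nth_mem by metis
    then show ?thesis using assms(2) by auto
  qed
  show "inj_on (odd_map cs) (elements P)"
  proof
    fix i j assume ij: "i \<in> elements P" "j \<in> elements P" "odd_map cs i = odd_map cs j"
    then have "nat \<bar>i\<bar> - 1 = nat \<bar>j\<bar> - 1"
      using abs[OF ij(1)] abs[OF ij(2)] nth_eq_iff_index_eq[OF assms(1)] by metis
    then have "i = j \<or> i = - j" using ij(1,2) unfolding el' by linarith
    then show "i = j" using odd[OF ij(2)] nz[OF ij(2)] ij(3) by auto
  qed
qed (unfold el, auto)

lemma elements_P1: "elements P1 = {-5, -4, -3, -2, -1, 1, 2, 3, 4, 5}"
  unfolding elements_def by auto

lemma elements_P2: "elements P2 = {-5, -4, -3, -2, -1, 1, 2, 3, 4, 5}"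
  unfolding elements_def by auto

lemma odd_map_P1:
  "image_mset (odd_map [a, b, c, d, e]) ` P1 =
    {{#a, a, a#}, {#b, b, b#}, {#-b, -c, -c#}, {#-a, -d, -d#}, {#-a, c, -e#}, {#-b, d, e#}}"
  by (simp add: odd_map_def numeral_eq_Suc)

lemma odd_map_P2:
  "image_mset (odd_map [a, b, c, d, e]) ` P2 =
    {{#a, a, a#}, {#b, b, b#}, {#-b, -c, -c#}, {#-a, -d, -d#}, {#c, d, e#}, {#-a, -b, -e#}}"
  by (simp add: odd_map_def numeral_eq_Suc)

lemma star_colored_pot_iso:
  assumes k: "star_colored k" and colors: "card (abs_colors k) \<le> 5"
    and tiles: "card (range (vertex_tile k)) \<le> 6"
  shows "pot_iso (range (vertex_tile k)) P1 \<or> pot_iso (range (vertex_tile k)) P2"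
proof -
  obtain x y x' y' where xy: "x \<noteq> y" "vertex_tile k x = vertex_tile k y"
    and xy': "x' \<noteq> y'" "vertex_tile k x' = vertex_tile k y'" and disj: "{x, y} \<inter> {x', y'} = {}"
    using two_pairs_of_equal_tiles[OF k tiles] .
  obtain p q r s p' q' where fr: "frame x y p q r s p' q'"
    using frame_exists[OF xy(1) tile_eq_parity[OF k xy(2)]] .
  have "{x', y'} = {r, s}"
    using second_pair_opposite[OF k colors fr xy(2) xy' disj] .
  then have rs: "vertex_tile k r = vertex_tile k s"
    using xy'(2) by (auto simp: doubleton_eq_iff)
  have skew: "k v u = - k u v" and nz: "k u v \<noteq> 0" if "adj u v" for u v
    using k that unfolding star_colored_def by blast+
  note ad = frame_adj[OF fr] and ft = frame_tiles[OF fr, of k]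
  note 1 = tile_eq_frame[OF k xy(2) fr] and 2 = tile_eq_frame(1,2)[OF k rs frame_swap(4)[OF fr]]
  define A where "A = k p x"
  define B where "B = k q x"
  define C where "C = k x r"
  define A' where "A' = k p' r"
  define B' where "B' = k q' r"
  note defs = A_def B_def C_def A'_def B'_def
  have eqs: "k x p = - A" "k x q = - B" "k p x = A" "k q x = B" "k y p = - A" "k y q = - B"
    "k p y = A" "k q y = B" "k x r = C" "k r x = - C" "k p' r = A'" "k q' r = B'"
    "k r p' = - A'" "k r q' = - B'" "k s p' = - A'" "k s q' = - B'" "k p' s = A'" "k q' s = B'"
    unfolding defs
    using 1 2 skew[OF ad(1)] skew[OF ad(2)] skew[OF ad(3)] skew[OF ad(4)] skew[OF ad(5)]
      skew[OF ad(14)] skew[OF ad(15)] skew[OF ad(17)] skew[OF ad(18)] by simp_all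
  have pp': "k p' p = - k p p'" and qq': "k q' q = - k q q'" by (rule skew[OF ad(9)], rule skew[OF ad(12)])
  have range: "range (vertex_tile k) = {{#-A, -B, C#}, {#A, A, k p p'#}, {#B, B, k q q'#},
      {#-C, -A', -B'#}, {#- k p p', A', A'#}, {#- k q q', B', B'#}}"
  proof -
    have "(UNIV :: vertex set) = {x, y, p, q, r, s, p', q'}"
      using fr unfolding frame_def by (elim conjE)
    then have "range (vertex_tile k) = vertex_tile k ` {x, y, p, q, r, s, p', q'}" by simp
    also have "\<dots> = {vertex_tile k x, vertex_tile k p, vertex_tile k q, vertex_tile k r,
        vertex_tile k p', vertex_tile k q'}"
      unfolding image_insert image_empty xy(2) rs by (simp only: insert_commute insert_absorb2)
    finally show ?thesis unfolding ft by (simp only: eqs pp' qq')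
  qed
  have "distinct [\<bar>A\<bar>, \<bar>B\<bar>, \<bar>C\<bar>, \<bar>A'\<bar>, \<bar>B'\<bar>]"
    using frame_colors(1)[OF k colors fr xy(2) rs] unfolding eqs abs_minus_cancel .
  moreover have "A \<noteq> 0" "B \<noteq> 0" "C \<noteq> 0" "A' \<noteq> 0" "B' \<noteq> 0"
    unfolding defs using nz[OF ad(7)] nz[OF ad(10)] nz[OF ad(3)] nz[OF ad(20)] nz[OF ad(23)] .
  \<comment> \<open>One substitution for each outcome of the two binary choices. Its first two
    entries are the values of the monochromatic tiles, which sit at \<open>p, q'\<close> or
    \<open>p', q\<close> for \<open>P1\<close> and at \<open>p, q\<close> or \<open>p', q'\<close>
    for \<open>P2\<close>.\<close>
  ultimately have P1: "pot_iso (image_mset (odd_map cs) ` P1) P1"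
    and P2: "pot_iso (image_mset (odd_map cs) ` P2) P2"
    if "cs \<in> {[A, B', - B, - A', - C], [A, B, - B', - A', - C], [A', B, - B', - A, C], [A', B', - B, - A, C]}" for cs
    using that by (intro odd_map elements_P1 elements_P2; auto)+
  have p: "k p p' = A \<or> k p p' = - A'"
    using frame_colors(2)[OF k colors fr xy(2) rs] unfolding eqs pp' by auto
  have q: "k q q' = B \<or> k q q' = - B'"
    using frame_colors(2)[OF k colors frame_swap(2)[OF fr] xy(2) rs] unfolding eqs qq' by auto
  have "range (vertex_tile k) = image_mset (odd_map [A, B', - B, - A', - C]) ` P1"
    if "k p p' = A" "k q q' = - B'"
    unfolding range that odd_map_P1 by (simp add: insert_commute add_mset_commute)
  moreover have "range (vertex_tile k) = image_mset (odd_map [A, B, - B', - A', - C]) ` P2"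
    if "k p p' = A" "k q q' = B"
    unfolding range that odd_map_P2 by (simp add: insert_commute add_mset_commute)
  moreover have "range (vertex_tile k) = image_mset (odd_map [A', B, - B', - A, C]) ` P1"
    if "k p p' = - A'" "k q q' = B"
    unfolding range that odd_map_P1 by (simp add: insert_commute add_mset_commute)
  moreover have "range (vertex_tile k) = image_mset (odd_map [A', B', - B, - A, C]) ` P2"
    if "k p p' = - A'" "k q q' = - B'"
    unfolding range that odd_map_P2 by (simp add: insert_commute add_mset_commute)
  ultimately show ?thesis using p q P1 P2 by (metis insertCI)
qed

section \<open>The pot P1 3-realizes the cube\<close>

lemma is_graph_cube: "is_graph cube"
proof -
  let ?R = "uadj cube"
  have R: "(x, y) \<in> ?R" if "adj x y" for x y
    using that uedges_cube_iff[of x y] unfolding uadj_def by (auto simp: cube_def)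
  have conn: "(x, y) \<in> ?R\<^sup>*" for x y
  proof -
    have "{z. (x, z) \<in> ?R\<^sup>*} = {z. (y, z) \<in> ?R\<^sup>*}" for x y
    proof (rule adj_connected)
      fix x y assume "adj x y"
      then have "(x, y) \<in> ?R" "(y, x) \<in> ?R" using R adj_sym by blast+
      then show "{z. (x, z) \<in> ?R\<^sup>*} = {z. (y, z) \<in> ?R\<^sup>*}"
        by (intro Collect_cong iffI) (erule converse_rtrancl_into_rtrancl[rotated]; assumption)+
    qed
    then show ?thesis by (metis (mono_tags) mem_Collect_eq rtrancl.rtrancl_refl)
  qed
  have "uedges cube \<subseteq> (\<Union>x. range (Upair x))" by (auto simp: cube_def)
  moreover have "finite (\<Union>x::vertex. range (Upair x))"
    by (intro finite_UN_I finite_imageI finite_vertex)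
  ultimately have "finite (uedges cube)" by (rule finite_subset)
  then show ?thesis
    unfolding is_graph_def using conn finite_vertex by (simp add: cube_def)
qed

text \<open>The converse of the passage to \<open>signed_color\<close>: a nowhere zero
  skew-symmetric function orients each edge towards its positive value and colors it by the absolute
  value.\<close>

lemma realizes_cubeI:
  assumes k: "\<And>x y. adj x y \<Longrightarrow> k y x = - k x y \<and> k x y \<noteq> 0 \<and> \<bar>k x y\<bar> \<le> int c"
    and P: "range (vertex_tile k) \<subseteq> P"
  shows "realizes P cube"
proof -
  define tl where "tl e = (SOME x. \<exists>y. e = Upair x y \<and> k x y > 0)" for e
  define hd where "hd e = (SOME y. e = Upair (tl e) y)" for e
  define D where "D = \<lparr>verts = UNIV, arcs = uedges cube, tail = tl, head = hd\<rparr>"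
  define l where "l e = \<bar>k (tl e) (hd e)\<bar>" for e
  have th: "tl (Upair x y) = x" "hd (Upair x y) = y" if "adj x y" "k x y > 0" for x y
  proof -
    have "k y x < 0" using k[OF that(1)] that(2) by simp
    then have "x' = x" if "Upair x y = Upair x' y'" "k x' y' > 0" for x' y'
      using that by auto
    then show "tl (Upair x y) = x"
      unfolding tl_def using that(2) by (intro some_equality) blast+
    then show "hd (Upair x y) = y"
      unfolding hd_def by (intro some_equality) auto
  qed
  have pos: "k x y > 0 \<or> k y x > 0" if "adj x y" for x y
    using k[OF that] by linarith
  have edge: "\<exists>x y. e = Upair x y \<and> adj x y \<and> k x y > 0 \<and> tl e = x \<and> hd e = y" if "e \<in> uedges cube" for e
  proof -
    obtain x y where e: "e = Upair x y" by (metis uprod_exhaust)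
    then have "adj x y" using that uedges_cube_iff by blast
    then show ?thesis
      using pos[of x y] th[of x y] th[of y x] adj_sym[of x y] unfolding e by (metis Upair_inject)
  qed
  have o: "orientation_of D cube"
    unfolding orientation_of_def
  proof (intro conjI ballI)
    fix e assume "e \<in> arcs D"
    then have "e \<in> uedges cube" by (simp add: D_def)
    then have "e = Upair (tl e) (hd e)" using edge by metis
    then show "Upair (tail D e) (head D e) = uends cube e"
      by (simp add: D_def cube_def)
  qed (simp_all add: D_def cube_def)
  have c: "edge_coloring D c l"
    unfolding edge_coloring_def
  proof
    fix e assume "e \<in> arcs D"
    then have "e \<in> uedges cube" by (simp add: D_def)
    then obtain x y where "adj x y" "tl e = x" "hd e = y" using edge by metis
    then show "l e \<in> {1..int c}" using k[of x y] unfolding l_def by auto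
  qed
  have "signed_color D l x y = k x y" if "adj x y" for x y
  proof (cases "k x y > 0")
    case True
    then show ?thesis
      using th[OF that True] by (simp add: signed_color_def D_def l_def)
  next
    case False
    then have "adj y x" "k y x > 0" using pos that adj_sym by blast+
    note th' = th[OF this]
    have "x \<noteq> y" using that by auto
    moreover have "tl (Upair x y) = y" "hd (Upair x y) = x"
      using th' by (metis Upair_inject)+
    ultimately show ?thesis
      using k[OF that] \<open>k y x > 0\<close> unfolding signed_color_def l_def D_def by simp
  qed
  then have "tile_at D l x = vertex_tile k x" for x
    unfolding tile_at_cube[OF o] vertex_tile_def
    by (intro image_mset_cong) (simp add: finite_vertex)
  then have "induced_pot D l \<subseteq> P"
    using P by (auto simp: induced_pot_def)
  then show ?thesis unfolding realizes_def using is_graph_cube o c by blast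
qed

text \<open>Colors 1 and 2 leave the stars at \<open>(1,0,0)\<close> and \<open>(0,1,1)\<close>;
  colors 3 and 4 enter those at \<open>(0,1,0)\<close> and \<open>(1,0,1)\<close>. The order of the
  tests settles the two edges between centers, and 5 goes to the two antipodal edges that
  remain.\<close>

definition P1_color :: "vertex \<Rightarrow> vertex \<Rightarrow> int" where
  "P1_color x y =
     (if x = (1,0,0) then 1 else if y = (1,0,0) then -1
      else if x = (0,1,1) then 2 else if y = (0,1,1) then -2
      else if x = (0,1,0) then -3 else if y = (0,1,0) then 3
      else if x = (1,0,1) then -4 else if y = (1,0,1) then 4
      else if x \<in> {(0,0,0), (1,1,0)} then -5 else 5)"

lemma realizes_P1_cube: "realizes P1 cube"
proof (rule realizes_cubeI[where k = P1_color and c = 5])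
  have "\<forall>x y. adj x y \<longrightarrow> P1_color y x = - P1_color x y \<and> P1_color x y \<noteq> 0 \<and> \<bar>P1_color x y\<bar> \<le> int 5"
    unfolding vertex_all by (simp add: adj_def P1_color_def zero_prod_def)
  then show "P1_color y x = - P1_color x y \<and> P1_color x y \<noteq> 0 \<and> \<bar>P1_color x y\<bar> \<le> int 5"
    if "adj x y" for x y using that by blast
  have "\<forall>x. vertex_tile P1_color x \<in> P1"
    unfolding vertex_all
    by (simp add: vertex_tile_def Collect_adj P1_color_def add_mset_commute)
  then show "range (vertex_tile P1_color) \<subseteq> P1" by blast
qed

text \<open>Positive labels keep the halves of a tile apart: positive entries come from tails and
  negative ones from heads, even at loops.\<close>

lemma count_tile_at:
  assumes "finite (arcs D)" "\<And>e. e \<in> arcs D \<Longrightarrow> l e > 0" "i > 0"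
  shows "count (tile_at D l v) i = card {e \<in> arcs D. l e = i \<and> tail D e = v}"
    "count (tile_at D l v) (- i) = card {e \<in> arcs D. l e = i \<and> head D e = v}"
proof -
  have *: "count (image_mset h (mset_set {e \<in> arcs D. u e = v})) j = card {e \<in> arcs D. h e = j \<and> u e = v}"
    for h :: "_ \<Rightarrow> int" and u j
  proof -
    have "count (image_mset h (mset_set {e \<in> arcs D. u e = v})) j
        = (\<Sum>e\<in>{e \<in> arcs D. h e = j \<and> u e = v}. 1)"
      unfolding count_image_mset' by (rule sum.cong) (use assms(1) in auto)
    then show ?thesis by simp
  qed
  have empty: "{e \<in> arcs D. - l e = i \<and> head D e = v} = {}" "{e \<in> arcs D. l e = - i \<and> tail D e = v} = {}"
    "{e \<in> arcs D. - l e = - i \<and> head D e = v} = {e \<in> arcs D. l e = i \<and> head D e = v}"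
    using assms(2,3) by force+
  then show "count (tile_at D l v) i = card {e \<in> arcs D. l e = i \<and> tail D e = v}"
    "count (tile_at D l v) (- i) = card {e \<in> arcs D. l e = i \<and> head D e = v}"
    unfolding tile_at_def count_union * empty by simp_all
qed

text \<open>Each edge has an end of even parity; there are four such vertices, each with three
  neighbors.\<close>

lemma card_uedges_cube: "card (uedges cube) \<le> 12"
proof -
  let ?S = "{x. parity x = 0}"
  have "uedges cube \<subseteq> (\<lambda>(x, y). Upair x y) ` (SIGMA x : ?S. {y. adj x y})"
  proof
    fix e assume e: "e \<in> uedges cube"
    obtain x y where xy: "e = Upair x y" by (metis uprod_exhaust)
    then have ad: "adj x y" using e uedges_cube_iff by blast
    then have "parity x = 0 \<or> parity y = 0" using adj_parity bit_cases by metis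
    then show "e \<in> (\<lambda>(x, y). Upair x y) ` (SIGMA x : ?S. {y. adj x y})"
    proof
      assume "parity x = 0"
      then show ?thesis using xy ad by (intro image_eqI[of _ _ "(x, y)"]) auto
    next
      assume "parity y = 0"
      then show ?thesis using xy ad adj_sym[of x y] by (intro image_eqI[of _ _ "(y, x)"]) auto
    qed
  qed
  then have "card (uedges cube) \<le> card (SIGMA x : ?S. {y. adj x y})"
    by (rule surj_card_le[rotated]) (intro finite_SigmaI finite_vertex)
  also have "\<dots> = (\<Sum>x\<in>?S. card {y. adj x y})"
    by (intro card_SigmaI ballI finite_vertex)
  also have "\<dots> \<le> (\<Sum>x\<in>?S. 3)"
    by (intro sum_mono) (simp only: Collect_adj card_insert_le_m1, simp add: card_insert_if)
  also have "\<dots> = 3 * card ?S" by simp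
  also have "?S \<subseteq> {(0,0,0), (0,1,1), (1,0,1), (1,1,0)}"
  proof
    have "\<forall>x. parity x = 0 \<longrightarrow> x \<in> {(0,0,0), (0,1,1), (1,0,1), (1,1,0)}"
      unfolding vertex_all by (simp add: parity_def)
    then show "x \<in> ?S \<Longrightarrow> x \<in> {(0,0,0), (0,1,1), (1,0,1), (1,1,0)}" for x by blast
  qed
  then have "card ?S \<le> card {(0,0,0) :: vertex, (0,1,1), (1,0,1), (1,1,0)}"
    by (intro card_mono finite_vertex)
  then have "3 * card ?S \<le> 12" by simp
  finally show ?thesis .
qed

text \<open>Counting the ends of each color shows that the tiles of \<open>P1\<close> occur with multiplicities
  proportional to \<open>1, 1, 1, 1, 2, 2\<close>.\<close>

lemma P1_tile_counts:
  fixes t :: "'v \<Rightarrow> int multiset"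
  assumes V: "finite V" "V \<noteq> {}" "card V \<le> 8" and t: "t ` V \<subseteq> P1"
    and bal: "\<And>i. i > 0 \<Longrightarrow> (\<Sum>v\<in>V. count (t v) i) = (\<Sum>v\<in>V. count (t v) (- i))"
  defines "n \<equiv> \<lambda>a. card {v \<in> V. t v = a}"
  shows "n {#1, 1, 1#} = 1" "n {#2, 2, 2#} = 1" "n {#-2, -3, -3#} = 1" "n {#-1, -4, -4#} = 1"
    "n {#-1, 3, -5#} = 2" "n {#-2, 4, 5#} = 2"
proof -
  let ?L = "[{#1, 1, 1#}, {#2, 2, 2#}, {#-2, -3, -3#}, {#-1, -4, -4#}, {#-1, 3, -5#}, {#-2, 4, 5#}] :: int multiset list"
  \<comment> \<open>The entry sums 3, 6, -8, -9, -3, 7 tell the tiles apart.\<close>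
  have "distinct (map sum_mset ?L)" by simp
  then have dL: "distinct ?L" by (simp only: distinct_map)
  have L: "P1 = set ?L" by simp
  have sum: "(\<Sum>v\<in>V. f (t v)) = (\<Sum>a\<leftarrow>?L. n a * f a)" for f
  proof -
    have "(\<Sum>v\<in>V. f (t v)) = (\<Sum>a\<in>P1. \<Sum>v\<in>{v \<in> V. t v = a}. f (t v))"
      by (rule sum.group[symmetric]) (use V t in simp_all)
    also have "\<dots> = (\<Sum>a\<in>P1. n a * f a)"
      by (rule sum.cong) (auto simp: n_def)
    finally show ?thesis
      unfolding L sum.distinct_set_conv_list[OF dL] .
  qed
  have 0: "card V = (\<Sum>a\<leftarrow>?L. n a)" using sum[of "\<lambda>_. 1"] by simp
  have e: "(\<Sum>v\<in>V. count (t v) i) = (\<Sum>a\<leftarrow>?L. n a * count a i)" for i by (rule sum)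
  note b = bal[of 1, unfolded e, simplified] bal[of 2, unfolded e, simplified]
    bal[of 3, unfolded e, simplified] bal[of 4, unfolded e, simplified]
    bal[of 5, unfolded e, simplified]
  \<comment> \<open>The proportions add up to eight, so a nonempty vertex set of at most eight
    elements leaves only the factor one.\<close>
  have "card V > 0" using V by (simp add: card_gt_0_iff)
  with 0 V(3) b show "n {#1, 1, 1#} = 1" "n {#2, 2, 2#} = 1" "n {#-2, -3, -3#} = 1" "n {#-1, -4, -4#} = 1"
    "n {#-1, 3, -5#} = 2" "n {#-2, 4, 5#} = 2"
    by auto
qed

lemma P1_color_skew: "adj x y \<Longrightarrow> P1_color y x = - P1_color x y"
proof -
  have "\<forall>x y. adj x y \<longrightarrow> P1_color y x = - P1_color x y"
    unfolding vertex_all by (simp add: adj_def P1_color_def zero_prod_def)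
  then show "adj x y \<Longrightarrow> P1_color y x = - P1_color x y" by blast
qed

text \<open>Tiles name the vertices up to the order within the two repeated tiles. Colors 1 to 4
  have a single center each; color 5 pairs the repeated tiles, and naming \<open>e1, e2\<close> as
  the partners of \<open>f1, f2\<close> removes this last freedom.\<close>

lemma P1_realization_unique:
  fixes H :: "('v, 'e) ugraph"
  assumes H: "realizes P1 H" and card: "card (uverts H) \<le> 8"
  shows "graph_iso H cube"
proof -
  obtain D m l where gr: "is_graph H" and o: "orientation_of D H" and col: "edge_coloring D m l"
    and pot: "induced_pot D l \<subseteq> P1"
    using H unfolding realizes_def by blast
  define V where "V = uverts H"
  define E where "E = uedges H"
  define t where "t = tile_at D l"
  have VE: "verts D = V" "arcs D = E" and ends: "\<And>e. e \<in> E \<Longrightarrow> uends H e = Upair (tail D e) (head D e)"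
    using o unfolding orientation_of_def V_def E_def by auto
  have fin: "finite V" "finite E" "V \<noteq> {}" using gr unfolding is_graph_def V_def E_def by auto
  have mem: "tail D e \<in> V" "head D e \<in> V" if "e \<in> E" for e
    using gr that ends[OF that] unfolding is_graph_def V_def E_def by fastforce+
  have pos: "l e > 0" if "e \<in> E" for e
  proof -
    have "l e \<in> {1..int m}" using col that VE unfolding edge_coloring_def by (auto dest: funcset_mem)
    then show ?thesis by simp
  qed
  have tV: "t ` V \<subseteq> P1" using pot unfolding induced_pot_def t_def VE .
  have out: "count (t v) i = card {e \<in> E. l e = i \<and> tail D e = v}"
    and inn: "count (t v) (- i) = card {e \<in> E. l e = i \<and> head D e = v}" if "i > 0" for v i
    unfolding t_def using count_tile_at[of D l i v] fin pos that VE by simp_all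
  have sum_out: "(\<Sum>v\<in>V. count (t v) i) = card {e \<in> E. l e = i}"
    and sum_in: "(\<Sum>v\<in>V. count (t v) (- i)) = card {e \<in> E. l e = i}" if "i > 0" for i
  proof -
    have *: "(\<Sum>v\<in>V. card {e \<in> E. l e = i \<and> u e = v}) = card {e \<in> E. l e = i}"
      if "\<And>e. e \<in> E \<Longrightarrow> u e \<in> V" for u
      using sum.group[of "{e \<in> E. l e = i}" V u "\<lambda>_. 1 :: nat"] fin that by (auto simp: conj_assoc)
    show "(\<Sum>v\<in>V. count (t v) i) = card {e \<in> E. l e = i}"
      "(\<Sum>v\<in>V. count (t v) (- i)) = card {e \<in> E. l e = i}"
      unfolding out[OF that] inn[OF that] using * mem by blast+
  qed
  \<comment> \<open>An entry of multiplicity one in a tile determines its arc; \<open>in1\<close> is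
    the same for heads.\<close>
  have out1: "e = e'" if "e \<in> E" "e' \<in> E" "l e = l e'" "tail D e = tail D e'" "count (t (tail D e)) (l e) = 1" for e e'
  proof -
    let ?S = "{e'' \<in> E. l e'' = l e \<and> tail D e'' = tail D e}"
    have "card ?S = 1" using that(5) unfolding out[OF pos[OF that(1)]] .
    then obtain z where "?S = {z}" by (rule card_1_singletonE)
    moreover have "e \<in> ?S" "e' \<in> ?S" using that by simp_all
    ultimately show ?thesis by (metis singletonD)
  qed
  have in1: "e = e'" if "e \<in> E" "e' \<in> E" "l e = l e'" "head D e = head D e'" "count (t (head D e)) (- l e) = 1" for e e'
  proof -
    let ?S = "{e'' \<in> E. l e'' = l e \<and> head D e'' = head D e}"
    have "card ?S = 1" using that(5) unfolding inn[OF pos[OF that(1)]] .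
    then obtain z where "?S = {z}" by (rule card_1_singletonE)
    moreover have "e \<in> ?S" "e' \<in> ?S" using that by simp_all
    ultimately show ?thesis by (metis singletonD)
  qed
  have tl: "l e \<in># t (tail D e)" and hd: "- l e \<in># t (head D e)" if "e \<in> E" for e
  proof -
    have "e \<in> {e' \<in> E. l e' = l e \<and> tail D e' = tail D e}" "e \<in> {e' \<in> E. l e' = l e \<and> head D e' = head D e}"
      using that by auto
    then have "count (t (tail D e)) (l e) \<noteq> 0" "count (t (head D e)) (- l e) \<noteq> 0"
      unfolding out[OF pos[OF that]] inn[OF pos[OF that]] using fin by auto
    then show "l e \<in># t (tail D e)" "- l e \<in># t (head D e)"
      by (simp_all add: count_eq_zero_iff)
  qed
  have "(\<Sum>v\<in>V. count (t v) i) = (\<Sum>v\<in>V. count (t v) (- i))" if "i > 0" for i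
    using sum_out[OF that] sum_in[OF that] by simp
  note n = P1_tile_counts[OF fin(1,3) card[folded V_def] tV this]
  obtain a where a: "{v \<in> V. t v = {#1, 1, 1#}} = {a}" using n(1) by (rule card_1_singletonE)
  obtain b where b: "{v \<in> V. t v = {#2, 2, 2#}} = {b}" using n(2) by (rule card_1_singletonE)
  obtain c where c: "{v \<in> V. t v = {#-2, -3, -3#}} = {c}" using n(3) by (rule card_1_singletonE)
  obtain d where d: "{v \<in> V. t v = {#-1, -4, -4#}} = {d}" using n(4) by (rule card_1_singletonE)
  obtain f1 f2 where f: "{v \<in> V. t v = {#-2, 4, 5#}} = {f1, f2}" "f1 \<noteq> f2" using n(6) by (auto simp: card_2_iff)
  have tf: "t f1 = {#-2, 4, 5#}" "t f2 = {#-2, 4, 5#}" using f(1) by auto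
  have "5 \<in># t f1" "5 \<in># t f2" using tf by simp_all
  then obtain m1 m2 where m: "m1 \<in> E" "l m1 = 5" "tail D m1 = f1" "m2 \<in> E" "l m2 = 5" "tail D m2 = f2"
    using out[of 5 f1] out[of 5 f2] fin by (auto simp: card_gt_0_iff simp flip: count_greater_zero_iff)
  define e1 where "e1 = head D m1"
  define e2 where "e2 = head D m2"
  have tP: "t v = {#1, 1, 1#} \<or> t v = {#2, 2, 2#} \<or> t v = {#-2, -3, -3#} \<or> t v = {#-1, -4, -4#} \<or>
      t v = {#-1, 3, -5#} \<or> t v = {#-2, 4, 5#}" if "v \<in> V" for v
    using tV that by auto
  have minus5: "t v = {#-1, 3, -5#}" if "v \<in> V" "-5 \<in># t v" for v
    using tP[OF that(1)] that(2) by auto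
  have te: "t e1 = {#-1, 3, -5#}" "t e2 = {#-1, 3, -5#}"
    unfolding e1_def e2_def
    using minus5[OF mem(2)[OF m(1)]] minus5[OF mem(2)[OF m(4)]] hd[OF m(1)] hd[OF m(4)] m(2,5)
    by simp_all
  have ne: "e1 \<noteq> e2"
  proof
    assume "e1 = e2"
    then have "m1 = m2" using in1[OF m(1,4)] m te unfolding e1_def e2_def by simp
    then show False using f m by simp
  qed
  have "{e1, e2} \<subseteq> {v \<in> V. t v = {#-1, 3, -5#}}"
    using te mem m unfolding e1_def e2_def by auto
  then have e: "{v \<in> V. t v = {#-1, 3, -5#}} = {e1, e2}"
    using n(5) ne fin by (intro card_seteq[symmetric]) auto
  have t: "t a = {#1, 1, 1#}" "t b = {#2, 2, 2#}" "t c = {#-2, -3, -3#}" "t d = {#-1, -4, -4#}"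
    "t e1 = {#-1, 3, -5#}" "t e2 = {#-1, 3, -5#}" "t f1 = {#-2, 4, 5#}" "t f2 = {#-2, 4, 5#}"
    using a b c d te tf by auto
  have V: "V = {a, b, c, d, e1, e2, f1, f2}"
  proof
    show "V \<subseteq> {a, b, c, d, e1, e2, f1, f2}"
    proof
      fix v assume "v \<in> V"
      with tP[OF this] have "v \<in> {a} \<or> v \<in> {b} \<or> v \<in> {c} \<or> v \<in> {d} \<or> v \<in> {e1, e2} \<or> v \<in> {f1, f2}"
        unfolding a[symmetric] b[symmetric] c[symmetric] d[symmetric] e[symmetric] f(1)[symmetric] by blast
      then show "v \<in> {a, b, c, d, e1, e2, f1, f2}" by auto
    qed
    show "{a, b, c, d, e1, e2, f1, f2} \<subseteq> V" using a b c d e f(1) by blast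
  qed
  have dist: "distinct [a, b, c, d, e1, e2, f1, f2]"
  proof -
    have "distinct (map (sum_mset \<circ> t) [a, b, c, d, e1, f1])" "sum_mset (t e1) = sum_mset (t e2)"
      "sum_mset (t f1) = sum_mset (t f2)" by (simp_all add: t)
    then show ?thesis using ne f(2) by auto
  qed
  have tail_cases: "tail D x = a \<and> l x = 1 \<or> tail D x = b \<and> l x = 2 \<or> (tail D x = e1 \<or> tail D x = e2) \<and> l x = 3 \<or>
      (tail D x = f1 \<or> tail D x = f2) \<and> (l x = 4 \<or> l x = 5)" if "x \<in> E" for x
    using tl[OF that] pos[OF that] mem(1)[OF that] t unfolding V by auto
  have head_cases: "head D x = c \<and> (l x = 2 \<or> l x = 3) \<or> head D x = d \<and> (l x = 1 \<or> l x = 4) \<or>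
      (head D x = e1 \<or> head D x = e2) \<and> (l x = 1 \<or> l x = 5) \<or> (head D x = f1 \<or> head D x = f2) \<and> l x = 2" if "x \<in> E" for x
    using hd[OF that] pos[OF that] mem(2)[OF that] t unfolding V by (auto simp: minus_equation_iff)
  have five: "head D x = (if tail D x = f1 then e1 else e2)" if "x \<in> E" "l x = 5" for x
  proof (cases "tail D x = f1")
    case True
    then have "x = m1" using out1[OF that(1) m(1)] that m t by simp
    then show ?thesis using True by (simp add: e1_def)
  next
    case False
    then have "tail D x = f2" using tail_cases[OF that(1)] that(2) by auto
    then have "x = m2" using out1[OF that(1) m(4)] that m t by simp
    then show ?thesis using False by (simp add: e2_def)
  qed
  \<comment> \<open>Sends each vertex to a cube vertex with the same tile under
    \<open>P1_color\<close>, placing \<open>e1, e2\<close> so that the arcs of color 5 become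
    edges.\<close>
  define \<phi> :: "'v \<Rightarrow> vertex" where "\<phi> v = (if v = a then (1,0,0) else if v = b then (0,1,1)
    else if v = c then (0,1,0) else if v = d then (1,0,1) else if v = e1 then (0,0,0)
    else if v = e2 then (1,1,0) else if v = f1 then (0,0,1) else (1,1,1))" for v
  have \<phi>: "\<phi> a = (1,0,0)" "\<phi> b = (0,1,1)" "\<phi> c = (0,1,0)" "\<phi> d = (1,0,1)" "\<phi> e1 = (0,0,0)"
    "\<phi> e2 = (1,1,0)" "\<phi> f1 = (0,0,1)" "\<phi> f2 = (1,1,1)"
    using dist unfolding \<phi>_def by auto
  have \<phi>V: "\<phi> ` V = UNIV" unfolding V UNIV_vertex image_insert image_empty \<phi> by (simp only: insert_commute)
  have "card V = 8" unfolding V using distinct_card[OF dist] by simp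
  then have inj\<phi>: "inj_on \<phi> V"
    using \<phi>V fin by (intro eq_card_imp_inj_on) (simp_all add: UNIV_vertex)
  \<comment> \<open>Possible tails and heads of each color combine to the twelve triples below,
    except that color 5 would also allow the crossed pairing, which \<open>five\<close>
    excludes.\<close>
  define Q where "Q u v i \<longleftrightarrow> adj (\<phi> u) (\<phi> v) \<and> P1_color (\<phi> u) (\<phi> v) = i" for u v i
  have Q: "Q a d 1" "Q a e1 1" "Q a e2 1" "Q b c 2" "Q b f1 2" "Q b f2 2" "Q e1 c 3" "Q e2 c 3"
    "Q f1 d 4" "Q f2 d 4" "Q f1 e1 5" "Q f2 e2 5"
    unfolding Q_def \<phi> by (simp_all add: adj_def P1_color_def zero_prod_def)
  have QE: "Q (tail D x) (head D x) (l x)" if "x \<in> E" for x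
  proof (cases "l x = 5")
    case True
    then have "tail D x = f1 \<or> tail D x = f2" using tail_cases[OF that] by simp
    then show ?thesis using five[OF that True] True f(2) Q(11,12) by auto
  next
    case False
    then show ?thesis
      using tail_cases[OF that] head_cases[OF that] Q(1-10)
      by (elim disjE conjE) simp_all
  qed
  then have arc: "adj (\<phi> (tail D x)) (\<phi> (head D x)) \<and> P1_color (\<phi> (tail D x)) (\<phi> (head D x)) = l x"
    if "x \<in> E" for x using that unfolding Q_def by blast
  define g where "g x = Upair (\<phi> (tail D x)) (\<phi> (head D x))" for x
  have injg: "inj_on g E"
  proof
    fix x y assume xy: "x \<in> E" "y \<in> E" "g x = g y"
    note ax = arc[OF xy(1)] and ay = arc[OF xy(2)]
    have "\<not> (\<phi> (tail D x) = \<phi> (head D y) \<and> \<phi> (head D x) = \<phi> (tail D y))"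
      using ax ay P1_color_skew[of "\<phi> (tail D x)" "\<phi> (head D x)"] pos[OF xy(1)] pos[OF xy(2)] by auto
    then have eq: "\<phi> (tail D x) = \<phi> (tail D y)" "\<phi> (head D x) = \<phi> (head D y)"
      using xy(3) unfolding g_def by auto
    then have th: "tail D x = tail D y" "head D x = head D y"
      using inj\<phi> mem xy(1,2) by (auto dest: inj_onD)
    moreover have l: "l x = l y" using ax ay unfolding eq by simp
    \<comment> \<open>Colors 1 and 2 occur once at every head and colors 3, 4, 5 once at every tail,
      so parallel arcs of one color coincide.\<close>
    moreover have "count (t (tail D x)) (l x) = 1 \<or> count (t (head D x)) (- l x) = 1"
      using tail_cases[OF xy(1)] head_cases[OF xy(1)] by (elim disjE conjE) (simp_all add: t)
    ultimately show "x = y" using out1 in1 xy by blast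
  qed
  \<comment> \<open>The five colors contribute 3, 3, 2, 2, 2 arcs, enough for the injective
    \<open>g\<close> to reach every edge of the cube.\<close>
  have "card E = 12"
  proof -
    have s: "(\<Sum>v\<in>V. h v) = h a + h b + h c + h d + h e1 + h e2 + h f1 + h f2" for h :: "'v \<Rightarrow> nat"
      unfolding V using sum.distinct_set_conv_list[OF dist, of h] by simp
    have "card E = (\<Sum>i\<in>{1,2,3,4,5}. card {x \<in> E. l x = i})"
      using sum.group[of E "{1,2,3,4,5}" l "\<lambda>_. 1 :: nat"] fin tail_cases by fastforce
    also have "\<dots> = 12" by (simp add: sum_out[symmetric] s t)
    finally show ?thesis .
  qed
  moreover have "g ` E \<subseteq> uedges cube" using arc uedges_cube_iff unfolding g_def by blast
  moreover have "finite (uedges cube)" using is_graph_cube unfolding is_graph_def by blast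
  ultimately have "g ` E = uedges cube"
    using card_uedges_cube card_image[OF injg] by (intro card_seteq) auto
  then have "bij_betw g (uedges H) (uedges cube)" using injg unfolding bij_betw_def E_def by simp
  moreover have "bij_betw \<phi> (uverts H) (uverts cube)"
    using inj\<phi> \<phi>V unfolding bij_betw_def V_def cube_def by simp
  moreover have "uends cube (g x) = map_uprod \<phi> (uends H x)" if "x \<in> uedges H" for x
    using ends that unfolding g_def E_def by (simp add: cube_def)
  ultimately show ?thesis unfolding graph_iso_def by blast
qed

section \<open>Minimality and the classification of biminimal pots\<close>

lemma card_uverts_cube: "card (uverts cube) = 8"
  by (simp add: cube_def UNIV_vertex)

lemma three_realizes_P1_cube: "three_realizes P1 cube"
  unfolding three_realizes_def card_uverts_cube
  using realizes_P1_cube P1_realization_unique by blast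

lemma realizes_mono: "realizes Q G \<Longrightarrow> Q \<subseteq> P \<Longrightarrow> realizes P G"
  unfolding realizes_def by blast

text \<open>Shrinking a pot only removes competitors, and the inducing coloring still realizes
  \<open>G\<close>.\<close>

lemma three_realizes_induced_pot:
  assumes P: "three_realizes P G" and D: "orientation_of D G" "edge_coloring D c l" "induced_pot D l \<subseteq> P"
  shows "three_realizes (induced_pot D l) G"
  using assms realizes_mono[OF _ D(3)] unfolding three_realizes_def realizes_def by blast

theorem theorem2:
  fixes P :: pot
  assumes "biminimal P cube"
  shows "pot_iso P {{#1, 1, 1#}, {#2, 2, 2#}, {#-2, -3, -3#},
                    {#-1, -4, -4#}, {#-1, 3, -5#}, {#-2, 4, 5#}} \<or>
         pot_iso P {{#1, 1, 1#}, {#2, 2, 2#}, {#-2, -3, -3#},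
                    {#-1, -4, -4#}, {#3, 4, 5#}, {#-1, -2, -5#}}"
proof -
  have P: "three_realizes P cube" and T3: "ecard P = T3 cube" and B3: "ecard (colors P) = B3 cube"
    using assms unfolding biminimal_def by auto
  obtain D c l where D: "orientation_of D cube" "edge_coloring D c l" and sub: "induced_pot D l \<subseteq> P"
    using P unfolding three_realizes_def realizes_def by blast
  let ?Q = "induced_pot D l"
  have T3_le: "T3 cube \<le> ecard Q" and B3_le: "B3 cube \<le> ecard (colors Q)" if "three_realizes Q cube" for Q
    using that unfolding T3_def B3_def by (auto intro: INF_lower)
  have "card P1 \<le> length [{#1, 1, 1#}, {#2, 2, 2#}, {#-2, -3, -3#}, {#-1, -4, -4#}, {#-1, 3, -5#}, {#-2, 4, 5#} :: tile]"
    using card_length[of "[{#1, 1, 1#}, {#2, 2, 2#}, {#-2, -3, -3#}, {#-1, -4, -4#}, {#-1, 3, -5#}, {#-2, 4, 5#} :: tile]"]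
    by simp
  then have "ecard P1 \<le> 6" by (simp add: ecard_def numeral_eq_enat)
  then have "ecard P \<le> 6" using T3 T3_le[OF three_realizes_P1_cube] by auto
  then have P6: "finite P" "card P \<le> 6"
    by (auto simp: ecard_def numeral_eq_enat split: if_splits)
  have "colors P1 = {1, 2, 3, 4, 5}" unfolding colors_def by auto
  then have "ecard (colors P1) = 5" by (simp add: ecard_def numeral_eq_enat)
  then have "ecard (colors P) \<le> 5" using B3 B3_le[OF three_realizes_P1_cube] by auto
  then have C5: "finite (colors P)" "card (colors P) \<le> 5"
    by (auto simp: ecard_def numeral_eq_enat split: if_splits)
  \<comment> \<open>The induced pot 3-realizes the cube as well, so a minimal \<open>P\<close>
    cannot contain tiles beyond it.\<close>
  have "ecard P \<le> ecard ?Q"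
    using T3 T3_le[OF three_realizes_induced_pot[OF P D sub]] by simp
  then have "card P \<le> card ?Q"
    using P6(1) finite_subset[OF sub] by (simp add: ecard_def)
  then have QP: "?Q = P" using P6(1) sub by (intro card_seteq)
  let ?k = "signed_color D l"
  have k: "star_colored ?k"
    unfolding star_colored_def using signed_color_cube[OF P D sub] by blast
  have range: "range (vertex_tile ?k) = P"
  proof -
    have "tile_at D l = vertex_tile ?k"
      using tile_at_cube[OF D(1)] unfolding vertex_tile_def by blast
    then show ?thesis using QP unfolding induced_pot_def orientation_cube(1)[OF D(1)] by simp
  qed
  \<comment> \<open>An edge contributes its color with positive sign at exactly one of its two ends,
    and \<open>colors\<close> sees it there.\<close>
  have "\<bar>?k u v\<bar> \<in> colors P" if "adj u v" for u v
  proof -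
    have "?k u v \<in># vertex_tile ?k u" "?k v u \<in># vertex_tile ?k v"
      using that adj_sym[of u v] unfolding vertex_tile_def by (simp_all add: finite_vertex)
    moreover have "?k v u = - ?k u v" and "?k u v \<noteq> 0"
      using k that unfolding star_colored_def by blast+
    moreover have "vertex_tile ?k w \<in> P" for w using range by blast
    ultimately have "?k u v > 0 \<Longrightarrow> ?k u v \<in> colors P" "?k u v < 0 \<Longrightarrow> - ?k u v \<in> colors P"
      unfolding colors_def mem_Collect_eq by (metis neg_0_less_iff_less)+
    then show ?thesis using \<open>?k u v \<noteq> 0\<close> by linarith
  qed
  then have "abs_colors ?k \<subseteq> colors P" unfolding abs_colors_def by blast
  then have "card (abs_colors ?k) \<le> 5" using card_mono[OF C5(1)] C5(2) le_trans by blast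
  then show ?thesis
    using star_colored_pot_iso[OF k] P6(2) unfolding range by blast
qed

end
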